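(* Let $W$ be a proper germ at $0$ of $q^{-\mathbf{N}}$-invariant open subset of $(\mathbf{C}^*,0)$, and consider functions (or vectors of functions) holomorphic on $W$. (i) For an integer $t>0$, $t$-flatness implies flatness in the sense of asymptotics. (ii) Solutions, holomorphic on $W$, of pure systems of (integral) slope $\mu$ are $\mu$-flat. (iii) If a solution, holomorphic on $W$, of a pure system of (integral) slope $\mu$ is $t$-flat for some integer $t>\mu$, then it is $0$.
   Context: Fix $q\in\mathbf{C}$ with $|q|>1$; $\sigma_q f(z)=f(qz)$, applied entrywise. $\mathbf{C}(\{z\})$ is the fraction field of the ring of convergent power series. $\theta_q(z)=\sum_{n\in\mathbf{Z}}q^{-n(n+1)/2}z^n$ and $\theta_{q,\lambda}(z)=\theta_q(z/\lambda)$ for $\lambda\in\mathbf{C}^*$; these are holomorphic on $\mathbf{C}^*$ and $\sigma_q\theta_{q,\lambda}=\frac{z}{\lambda}\theta_{q,\lambda}$. A pure system of integral slope $\mu$ is a system $\sigma_qX=BX$, $B\in GL_n(\mathbf{C}(\{z\}))$, such that $B=(\sigma_qF)(z^{-\mu}A)F^{-1}$ for some $F\in GL_n(\mathbf{C}(\{z\}))$ and $A\in GL_n(\mathbf{C})$. A function $f$ holomorphic on $W$ has level of flatness $\ge t$ ($t$ an integer), or is $t$-flat, if for one (hence any) theta function $\theta=\theta_{q,\lambda}$ the function $f|\theta|^t$ has polynomial growth near $0$, i.e. on every invariant relatively compact subset of $W$ (that is, on $q^{-\mathbf{N}}K$ for each compact $K\subset W$) it is $O(|z|^{-N})$ for some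 $N$ as $z\to0$. It is flat in the sense of asymptotics if for every $m\in\mathbf{N}$, $z^{-m}f$ is bounded on every such subset $q^{-\mathbf{N}}K$ (i.e. $f$ has asymptotic expansion $0$). For vectors, these properties are required entrywise. *)

theory Defs
  imports "HOL-Complex_Analysis.Complex_Analysis" "HOL-Library.Landau_Symbols"
begin

definition qtheta :: "complex \<Rightarrow> complex \<Rightarrow> complex" where
  "qtheta q z = (\<Sum>\<^sub>\<infinity>n\<in>(UNIV::int set). q powi (- (n * (n + 1) div 2)) * z powi n)"

definition qtheta_at :: "complex \<Rightarrow> complex \<Rightarrow> complex \<Rightarrow> complex" where
  "qtheta_at q l z = qtheta q (z / l)"

text \<open>
  A germ at \<open>0\<close> of open subset of the punctured plane, invariant under division by \<open>q\<close>, is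
  given by a representative \<open>W\<close>. It is proper if, as a germ, it differs from the germ of the
  whole punctured plane, i.e. if \<open>W\<close> contains no punctured neighbourhood of \<open>0\<close>.
\<close>

definition proper_invariant_germ :: "complex \<Rightarrow> complex set \<Rightarrow> bool" where
  "proper_invariant_germ q W \<longleftrightarrow>
     open W \<and> 0 \<notin> W \<and> (\<forall>z\<in>W. z / q \<in> W) \<and> \<not> eventually (\<lambda>z. z \<in> W) (at 0)"

definition q_orbit :: "complex \<Rightarrow> complex set \<Rightarrow> complex set" where
  "q_orbit q K = {z / q ^ n | z n. z \<in> K}"

text \<open>
  The theta function is asked for existentially: for \<open>t < 0\<close> the quotient by a theta function
  with a zero in \<open>W\<close> has poles in \<open>W\<close>, so independence of the choice holds for all theta
  functions if \<open>t \<ge> 0\<close>, but only among those without zeros in \<open>W\<close> (they exist as \<open>W\<close> is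
  proper) if \<open>t < 0\<close>.
\<close>

definition t_flat :: "complex \<Rightarrow> complex set \<Rightarrow> int \<Rightarrow> (complex \<Rightarrow> complex) \<Rightarrow> bool" where
  "t_flat q W t f \<longleftrightarrow>
     (\<exists>l. l \<noteq> 0 \<and>
       (\<forall>K. compact K \<and> K \<subseteq> W \<longrightarrow>
         (\<exists>N::nat. (\<lambda>z. norm (f z) * norm (qtheta_at q l z) powi t)
            \<in> O[at 0 within q_orbit q K](\<lambda>z. norm z powi (- int N)))))"

definition asymp_flat :: "complex \<Rightarrow> complex set \<Rightarrow> (complex \<Rightarrow> complex) \<Rightarrow> bool" where
  "asymp_flat q W f \<longleftrightarrow>
     (\<forall>m::nat. \<forall>K. compact K \<and> K \<subseteq> W \<longrightarrow>
        bounded ((\<lambda>z. z powi (- int m) * f z) ` q_orbit q K))"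

definition holomorphic_vec_on :: "(complex \<Rightarrow> complex ^ 'n) \<Rightarrow> complex set \<Rightarrow> bool" where
  "holomorphic_vec_on X W \<longleftrightarrow> (\<forall>i. (\<lambda>z. X z $ i) holomorphic_on W)"

definition t_flat_vec ::
  "complex \<Rightarrow> complex set \<Rightarrow> int \<Rightarrow> (complex \<Rightarrow> complex ^ 'n) \<Rightarrow> bool" where
  "t_flat_vec q W t X \<longleftrightarrow> (\<forall>i. t_flat q W t (\<lambda>z. X z $ i))"

definition asymp_flat_vec ::
  "complex \<Rightarrow> complex set \<Rightarrow> (complex \<Rightarrow> complex ^ 'n) \<Rightarrow> bool" where
  "asymp_flat_vec q W X \<longleftrightarrow> (\<forall>i. asymp_flat q W (\<lambda>z. X z $ i))"

text \<open>
  An element of the field of fractions of the ring of convergent power series is represented by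
  a function meromorphic at \<open>0\<close>, i.e. one that agrees near \<open>0\<close>, except possibly at \<open>0\<close> itself,
  with a convergent Laurent series with finite principal part. Two functions represent the same
  element iff they agree eventually at \<open>0\<close>.
\<close>

definition merom_germ_matrix :: "(complex \<Rightarrow> complex ^ 'n ^ 'n) \<Rightarrow> bool" where
  "merom_germ_matrix F \<longleftrightarrow> (\<forall>i j. (\<lambda>z. F z $ i $ j) meromorphic_on {0})"

definition GL_germ :: "(complex \<Rightarrow> complex ^ 'n ^ 'n) \<Rightarrow> bool" where
  "GL_germ F \<longleftrightarrow> merom_germ_matrix F \<and>
     (\<exists>G. merom_germ_matrix G \<and>
       (\<forall>\<^sub>F z in at 0. F z ** G z = mat 1 \<and> G z ** F z = mat 1))"

definition pure_system :: "complex \<Rightarrow> int \<Rightarrow> (complex \<Rightarrow> complex ^ 'n ^ 'n) \<Rightarrow> bool" where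
  "pure_system q \<mu> B \<longleftrightarrow> GL_germ B \<and>
     (\<exists>F A. GL_germ F \<and> invertible A \<and>
       (\<forall>\<^sub>F z in at 0.
          B z = F (q * z) ** (\<chi> i j. z powi (- \<mu>) * A $ i $ j) ** matrix_inv (F z)))"

text \<open>
  The germ of \<open>X (q z)\<close> lives on the set of \<open>z\<close> with \<open>q z \<in> W\<close>, which is contained in \<open>W\<close>
  by invariance; the equation is an equality of germs at \<open>0\<close> on that set.
\<close>

definition solves_system ::
  "complex \<Rightarrow> complex set \<Rightarrow> (complex \<Rightarrow> complex ^ 'n ^ 'n) \<Rightarrow> (complex \<Rightarrow> complex ^ 'n) \<Rightarrow> bool"
  where
  "solves_system q W B X \<longleftrightarrow>
     (\<forall>\<^sub>F z in at 0 within {z. q * z \<in> W}. X (q * z) = B z *v X z)"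

end

theory Submission
  imports Defs
begin

text \<open>
  Everything is read off along the orbits \<open>z, z / q, z / q ^ 2, \<dots>\<close>. The functional equation of theta
  gives \<open>qtheta_at q l (z / q ^ n) = (l / z) ^ n * q ^ (n (n + 1) / 2) * qtheta_at q l z\<close>
  (\<open>qtheta_at_iterate\<close>): the modulus of theta grows like \<open>norm q\<close> to a quadratic power of \<open>n\<close>, whereas
  powers of \<open>1 / norm z\<close> grow only geometrically in \<open>n\<close>.

  A \<open>t\<close>-flat function with \<open>t > 0\<close> is therefore smaller than every power of \<open>z\<close>, uniformly along
  the orbits of a compact set that avoids the zeros of theta. These zeros form a countable set, so every point of \<open>W\<close> is the
  centre of arbitrarily small circles without zeros, and the maximum modulus principle fills in the
  discs (\<open>t_flat_bounded_near_point\<close>, \<open>t_flat_imp_asymp_flat\<close>).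

  A pure system of slope \<open>\<mu>\<close> becomes \<open>Y (q z) = z powi (- \<mu>) A Y z\<close> after a meromorphic change of
  unknowns, which costs only a power of \<open>norm z\<close>. Up to the constant matrix \<open>A\<close> and a constant power
  of \<open>l\<close>, the theta function to the power \<open>- \<mu>\<close> obeys the same equation. So the product of \<open>norm (Y z)\<close>
  and theta to the power \<open>\<mu>\<close> grows at most geometrically along orbits, which is polynomial growth:
  solutions are \<open>\<mu>\<close>-flat (\<open>pure_solution_t_flat\<close>). Conversely, \<open>Y z\<close> is recovered from
  \<open>Y (z / q ^ n)\<close> with a loss of size theta to the power \<open>\<mu>\<close>. If the solution is \<open>t\<close>-flat with \<open>t > \<mu>\<close>,
  the gain outweighs the loss as \<open>n\<close> grows, which forces \<open>Y z = 0\<close> (\<open>pure_solution_vanishes\<close>).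

  For \<open>\<mu> < 0\<close> the product with theta to the power \<open>\<mu>\<close> is only under control if theta has no zeros in
  \<open>W\<close>. A proper germ \<open>W\<close> avoids some whole orbit (\<open>proper_germ_avoids_orbit\<close>), but possibly no more
  than one, so it matters that theta vanishes on a single orbit. This follows from the Jacobi
  triple product, obtained as the limit of its finite form (\<open>finite_triple_product\<close>,
  \<open>qtheta_nonzero\<close>).
\<close>

section \<open>Gaussian weights and the functional equation of theta\<close>

text \<open>
  The triangular numbers are the exponents of theta. Moving \<open>z\<close> to \<open>z / q ^ n\<close> multiplies
  \<open>qtheta q z\<close> by \<open>q ^ tri n / z ^ n\<close>, so they also measure the growth of theta along an orbit.
\<close>

definition tri :: "nat \<Rightarrow> nat" where
  "tri n = n * (n + 1) div 2"

lemma tri_0 [simp]: "tri 0 = 0"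
  by (simp add: tri_def)

lemma tri_Suc: "tri (Suc n) = tri n + Suc n"
  by (simp add: tri_def)

lemma two_tri: "2 * tri n = n * (n + 1)"
  by (simp add: tri_def)

text \<open>
  The one analytic estimate behind everything: \<open>r ^ tri n\<close> decays faster than any geometric
  sequence grows. It makes theta converge, and it makes a gain of a positive power of
  \<open>norm q powi (- tri n)\<close> outweigh all geometric and polynomial errors.
\<close>

lemma summable_gauss_weight:
  fixes r D :: real
  assumes "0 \<le> r" "r < 1"
  shows "summable (\<lambda>n. D ^ n * r ^ tri n)"
proof -
  have "(\<lambda>n. \<bar>D\<bar> * r ^ Suc n) \<longlonglongrightarrow> \<bar>D\<bar> * 0"
    by (intro tendsto_intros LIMSEQ_Suc LIMSEQ_realpow_zero) (use assms in auto)
  then have "eventually (\<lambda>n. \<bar>D\<bar> * r ^ Suc n < 1/2) sequentially"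
    by (rule order_tendstoD) simp
  then obtain M where M: "\<And>n. n \<ge> M \<Longrightarrow> \<bar>D\<bar> * r ^ Suc n < 1/2"
    by (auto simp: eventually_sequentially)
  show ?thesis
  proof (rule summable_ratio_test[where c = "1/2" and N = M])
    fix n assume "n \<ge> M"
    have "norm (D ^ Suc n * r ^ tri (Suc n)) = (\<bar>D\<bar> * r ^ Suc n) * norm (D ^ n * r ^ tri n)"
      unfolding tri_Suc power_add using assms by (simp add: abs_mult power_abs del: mult_Suc_right)
    also have "\<dots> \<le> 1/2 * norm (D ^ n * r ^ tri n)"
      by (rule mult_right_mono[OF less_imp_le[OF M[OF \<open>n \<ge> M\<close>]] norm_ge_zero])
    finally show "norm (D ^ Suc n * r ^ tri (Suc n)) \<le> 1/2 * norm (D ^ n * r ^ tri n)" .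
  qed simp
qed

lemma gauss_weight_tendsto_0:
  fixes r D :: real
  assumes "0 \<le> r" "r < 1"
  shows "(\<lambda>n. D ^ n * r ^ tri n) \<longlonglongrightarrow> 0"
  by (rule summable_LIMSEQ_zero[OF summable_gauss_weight[OF assms]])

text \<open>
  The part of the theta series with nonnegative exponents, an entire power series for
  \<open>norm p < 1\<close>, where \<open>p\<close> stands for \<open>1 / q\<close>.
\<close>

definition half_theta :: "complex \<Rightarrow> complex \<Rightarrow> complex" where
  "half_theta p z = (\<Sum>n. p ^ tri n * z ^ n)"

lemma summable_norm_half_theta:
  fixes p z :: complex
  assumes "norm p < 1"
  shows "summable (\<lambda>n. norm (p ^ tri n * z ^ n))"
  using summable_gauss_weight[of "norm p" "norm z"] assms
  by (simp add: norm_mult norm_power mult.commute)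

lemma isCont_half_theta:
  assumes "norm p < 1"
  shows "isCont (half_theta p) z"
  unfolding half_theta_def
  by (rule isCont_powser_converges_everywhere)
     (rule summable_norm_cancel[OF summable_norm_half_theta[OF assms]])

lemma half_theta_shift:
  assumes "norm p < 1" "p \<noteq> 0"
  shows "half_theta p (z / p) = 1 + z * half_theta p z"
proof -
  have "half_theta p (z / p) = p ^ tri 0 * (z / p) ^ 0 + (\<Sum>n. p ^ tri (Suc n) * (z / p) ^ Suc n)"
    unfolding half_theta_def
    by (subst suminf_split_head[OF summable_norm_cancel[OF summable_norm_half_theta[OF assms(1)]]])
       simp
  also have "(\<lambda>n. p ^ tri (Suc n) * (z / p) ^ Suc n) = (\<lambda>n. z * (p ^ tri n * z ^ n))"
    unfolding tri_Suc power_add using assms(2) by (simp add: fun_eq_iff power_divide field_simps)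
  also have "(\<Sum>n. z * (p ^ tri n * z ^ n)) = z * half_theta p z"
    unfolding half_theta_def
    by (rule suminf_mult[OF summable_norm_cancel[OF summable_norm_half_theta[OF assms(1)]]])
  finally show ?thesis by simp
qed

text \<open>
  The exponent \<open>n (n + 1) / 2\<close> is invariant under \<open>n \<mapsto> - 1 - n\<close>, so the terms with negative
  index form the same power series at \<open>1 / z\<close>, divided by \<open>z\<close>.
\<close>

lemma qtheta_eq_half_theta:
  assumes q: "norm q > 1" and z: "z \<noteq> 0"
  shows "qtheta q z = half_theta (inverse q) z + half_theta (inverse q) (inverse z) / z"
proof -
  define p where "p = inverse q"
  have p: "norm p < 1" using q by (simp add: p_def norm_inverse inverse_less_1_iff)
  define g where "g n = q powi (- (n * (n + 1) div 2)) * z powi n" for n :: int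
  have has: "((\<lambda>n. p ^ tri n * w ^ n) has_sum half_theta p w) UNIV" for w
    unfolding half_theta_def
    by (intro norm_summable_imp_has_sum summable_norm_half_theta[OF p] summable_sums
          summable_norm_cancel[OF summable_norm_half_theta[OF p]])
  have tri_int: "int n * (int n + 1) div 2 = int (tri n)" for n
    by (simp add: tri_def zdiv_int algebra_simps)
  have g_pos: "g (int n) = p ^ tri n * z ^ n" for n
    unfolding g_def tri_int by (simp add: p_def power_int_minus power_inverse)
  have g_neg: "g (- 1 - int n) = (p ^ tri n * inverse z ^ n) / z" for n
  proof -
    have e: "(- 1 - int n) * (- 1 - int n + 1) = int n * (int n + 1)" by (simp add: algebra_simps)
    have "z powi (- 1 - int n) = inverse z ^ n / z"
    proof -
      have "z powi (- 1 - int n) = z powi (- (int (Suc n)))" by (simp add: algebra_simps)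
      also have "\<dots> = inverse (z ^ Suc n)" unfolding power_int_minus power_int_of_nat ..
      finally show ?thesis by (simp add: power_inverse divide_inverse)
    qed
    then show ?thesis
      unfolding g_def e tri_int by (simp add: p_def power_int_minus power_inverse)
  qed
  have pos: "(g has_sum half_theta p z) (range int)"
    using has[of z] by (subst has_sum_reindex) (auto simp: o_def g_pos)
  have neg: "(g has_sum half_theta p (inverse z) / z) (range (\<lambda>n. - 1 - int n))"
    using has_sum_cmult_left[OF has[of "inverse z"], of "inverse z"]
    by (subst has_sum_reindex) (auto simp: o_def g_neg inj_on_def divide_inverse)
  have "range int \<union> range (\<lambda>n. - 1 - int n) = UNIV"
  proof (rule set_eqI, simp)
    fix x :: int
    show "x \<in> range int \<or> x \<in> range (\<lambda>n. - 1 - int n)"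
    proof (cases "x \<ge> 0")
      case True then show ?thesis by (metis nonneg_int_cases rangeI)
    next
      case False
      then have "x = - 1 - int (nat (- 1 - x))" by simp
      then show ?thesis by blast
    qed
  qed
  moreover have "range int \<inter> range (\<lambda>n. - 1 - int n) = {}" by auto
  ultimately have "(g has_sum half_theta p z + half_theta p (inverse z) / z) UNIV"
    using has_sum_Un_disjoint[OF pos neg] by simp
  then show ?thesis
    unfolding qtheta_def g_def[symmetric] p_def[symmetric] by (rule infsumI)
qed

lemma isCont_qtheta:
  assumes q: "norm q > 1" and z: "z \<noteq> 0"
  shows "isCont (qtheta q) z"
proof -
  have p: "norm (inverse q) < 1" using q by (simp add: norm_inverse inverse_less_1_iff)
  have c: "isCont (\<lambda>z. half_theta (inverse q) z + half_theta (inverse q) (inverse z) / z) z"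
    by (intro continuous_intros isCont_half_theta[OF p] isCont_o2[OF _ isCont_half_theta[OF p]])
       (use z in auto)
  have "eventually (\<lambda>w. w \<noteq> 0) (nhds z)" using z by (rule t1_space_nhds)
  then have "eventually (\<lambda>w. qtheta q w =
      half_theta (inverse q) w + half_theta (inverse q) (inverse w) / w) (nhds z)"
    by eventually_elim (rule qtheta_eq_half_theta[OF q])
  then show ?thesis using c isCont_cong by fast
qed

lemma qtheta_shift:
  assumes q: "norm q > 1" and z: "z \<noteq> 0"
  shows "qtheta q (q * z) = z * qtheta q z"
proof -
  define p where "p = inverse q"
  have p: "norm p < 1" "p \<noteq> 0" and q0: "q \<noteq> 0"
    using q by (auto simp: p_def norm_inverse inverse_less_1_iff)
  have 1: "half_theta p (q * z) = 1 + z * half_theta p z"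
    using half_theta_shift[OF p, of z] by (simp add: p_def divide_inverse mult.commute)
  have 2: "half_theta p (inverse z) = 1 + inverse (q * z) * half_theta p (inverse (q * z))"
  proof -
    have "inverse (q * z) / p = inverse z" using q0 by (simp add: p_def field_simps)
    then show ?thesis using half_theta_shift[OF p, of "inverse (q * z)"] by simp
  qed
  have "qtheta q (q * z) = half_theta p (q * z) + half_theta p (inverse (q * z)) / (q * z)"
    using qtheta_eq_half_theta[OF q, of "q * z"] z q0 by (simp add: p_def)
  also have "\<dots> = 1 + z * half_theta p z + (half_theta p (inverse z) - 1)"
    unfolding 1 2 by (simp add: divide_inverse)
  also have "\<dots> = z * (half_theta p z + half_theta p (inverse z) / z)"
    using z by (simp add: field_simps)
  also have "\<dots> = z * qtheta q z"
    using qtheta_eq_half_theta[OF q z] by (simp add: p_def)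
  finally show ?thesis .
qed

section \<open>The zeros of theta\<close>

text \<open>
  The \<open>q\<close>-Pochhammer symbol \<open>(p; p)\<^sub>n\<close>.
\<close>

definition qpoch :: "complex \<Rightarrow> nat \<Rightarrow> complex" where
  "qpoch p n = (\<Prod>i<n. 1 - p ^ Suc i)"

text \<open>
  The Gaussian binomial coefficient. The quotient form is convenient for limits; it is the usual
  polynomial in \<open>p\<close> when \<open>j \<le> n\<close> and \<open>p\<close> is not a root of unity.
\<close>

definition qbinom :: "complex \<Rightarrow> nat \<Rightarrow> nat \<Rightarrow> complex" where
  "qbinom p n j = qpoch p n / (qpoch p j * qpoch p (n - j))"

lemma qpoch_Suc: "qpoch p (Suc n) = qpoch p n * (1 - p ^ Suc n)"
  by (simp add: qpoch_def)

lemma one_minus_power_neq_0: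
  fixes p :: complex
  assumes "norm p < 1"
  shows "1 - p ^ Suc i \<noteq> 0"
proof -
  have "norm p ^ Suc i \<le> norm p ^ 1"
    by (rule power_decreasing) (use assms in auto)
  then have "norm (p ^ Suc i) < 1"
    using assms unfolding norm_power by simp
  then show ?thesis by auto
qed

lemma qpoch_neq_0: "norm p < 1 \<Longrightarrow> qpoch p n \<noteq> 0"
  using one_minus_power_neq_0[of p] by (auto simp: qpoch_def simp del: power_Suc)

text \<open>
  Over the common denominator \<open>(p; p)\<^sub>j\<^sub>+\<^sub>1 (p; p)\<^sub>n\<^sub>-\<^sub>j\<close> this reads
  \<open>1 - p ^ (n + 1) = (1 - p ^ (n - j)) + p ^ (n - j) (1 - p ^ (j + 1))\<close>.
\<close>

lemma qbinom_pascal: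
  assumes p: "norm p < 1" and j: "j < n"
  shows "qbinom p (Suc n) (Suc j) = qbinom p n (Suc j) + p ^ (n - j) * qbinom p n j"
proof -
  obtain m where m: "n = Suc (j + m)" using j less_imp_Suc_add by blast
  have nz: "qpoch p k \<noteq> 0" "1 - p ^ Suc k \<noteq> 0" for k
    using qpoch_neq_0[OF p] one_minus_power_neq_0[OF p] by auto
  have [simp]: "n - j = Suc m" "n - Suc j = m" using m by auto
  have "qbinom p n (Suc j) + p ^ (n - j) * qbinom p n j =
     (qpoch p n * (1 - p ^ Suc m) + p ^ Suc m * qpoch p n * (1 - p ^ Suc j)) /
      (qpoch p (Suc j) * qpoch p (Suc m))"
    unfolding qbinom_def using nz[of j] nz[of m] nz[of n]
    by (simp add: qpoch_Suc divide_simps del: power_Suc)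
  also have "qpoch p n * (1 - p ^ Suc m) + p ^ Suc m * qpoch p n * (1 - p ^ Suc j) =
      qpoch p (Suc n)"
  proof -
    have "p ^ Suc n = p ^ Suc m * p ^ Suc j" unfolding m power_add[symmetric] by (simp add: add_ac)
    then show ?thesis unfolding qpoch_Suc by (simp add: algebra_simps del: power_Suc)
  qed
  finally show ?thesis by (simp add: qbinom_def)
qed

lemma qbinom_theorem:
  assumes p: "norm p < 1"
  shows "(\<Prod>k<n. 1 + x * p ^ Suc k) = (\<Sum>j\<le>n. qbinom p n j * p ^ tri j * x ^ j)"
proof (induction n)
  case 0
  then show ?case by (simp add: qbinom_def qpoch_def)
next
  case (Suc n)
  have nz: "qpoch p k \<noteq> 0" for k using qpoch_neq_0[OF p] .
  define f where "f n j = qbinom p n j * p ^ tri j * x ^ j" for n j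
  have ends: "qbinom p n 0 = 1" "qbinom p n n = 1" for n
    using nz by (auto simp: qbinom_def) (auto simp: qpoch_def)
  have step: "f (Suc n) (Suc j) = f n (Suc j) + x * p ^ Suc n * f n j" if "j < n" for j
  proof -
    have "p ^ (n - j) * p ^ tri (Suc j) = p ^ Suc n * p ^ tri j"
      unfolding tri_Suc power_add[symmetric] using that by (intro arg_cong[of _ _ "power p"]) simp
    then show ?thesis
      unfolding f_def qbinom_pascal[OF p that]
      by (simp add: algebra_simps del: power_Suc) (simp add: algebra_simps)
  qed
  have last: "f (Suc n) (Suc n) = x * p ^ Suc n * f n n"
    unfolding f_def ends tri_Suc power_add by simp
  have "(\<Prod>k<Suc n. 1 + x * p ^ Suc k) = (\<Sum>j\<le>n. f n j) + x * p ^ Suc n * (\<Sum>j\<le>n. f n j)"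
    using Suc by (simp add: f_def algebra_simps)
  also have "(\<Sum>j\<le>n. f n j) = f n 0 + (\<Sum>j<n. f n (Suc j))"
    by (simp only: sum.lessThan_Suc_shift flip: lessThan_Suc_atMost)
  also have "x * p ^ Suc n * (f n 0 + (\<Sum>j<n. f n (Suc j))) = x * p ^ Suc n * (\<Sum>j\<le>n. f n j)"
    by (simp only: sum.lessThan_Suc_shift flip: lessThan_Suc_atMost)
  also have "\<dots> = (\<Sum>j<n. x * p ^ Suc n * f n j) + x * p ^ Suc n * f n n"
    by (simp add: sum_distrib_left distrib_left flip: lessThan_Suc_atMost)
  also have "f n 0 + (\<Sum>j<n. f n (Suc j)) + ((\<Sum>j<n. x * p ^ Suc n * f n j) + x * p ^ Suc n * f n n)
     = f (Suc n) 0 + ((\<Sum>j<n. f (Suc n) (Suc j)) + f (Suc n) (Suc n))"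
    using step last by (simp add: sum.distrib f_def ends del: power_Suc)
  also have "\<dots> = (\<Sum>j\<le>Suc n. f (Suc n) j)"
    unfolding lessThan_Suc_atMost[symmetric] sum.lessThan_Suc_shift[of _ "Suc n"] by simp
  finally show ?case by (simp add: f_def)
qed

lemma prod_lessThan_add:
  fixes f :: "nat \<Rightarrow> 'a :: comm_monoid_mult"
  shows "prod f {..<m + n} = prod f {..<m} * (\<Prod>k<n. f (m + k))"
  by (induction n) (simp_all add: mult.assoc)

lemma sum_lessThan_add:
  fixes f :: "nat \<Rightarrow> 'a :: comm_monoid_add"
  shows "sum f {..<m + n} = sum f {..<m} + (\<Sum>k<n. f (m + k))"
  by (induction n) (simp_all add: add.assoc)

lemma prod_power_lessThan:
  fixes p :: "'a :: comm_monoid_mult"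
  shows "(\<Prod>k<N. p ^ k) = p ^ tri (N - 1)"
proof (induction N)
  case (Suc N)
  have "tri (N - 1) + N = tri N" by (cases N) (auto simp: tri_Suc)
  then show ?case using Suc by (simp flip: power_add)
qed simp

text \<open>
  Cauchy's finite form of the Jacobi triple product. It is the \<open>q\<close>-binomial theorem for \<open>2 N\<close>
  factors at \<open>x = z / p ^ N\<close>: the first \<open>N\<close> factors then contain nonpositive powers of \<open>p\<close>, and
  pulling these out turns them into factors in \<open>1 / z\<close>, while the index is centred at \<open>N\<close>.
\<close>

lemma finite_triple_product:
  assumes p: "norm p < 1" "p \<noteq> 0" and z: "z \<noteq> 0"
  shows "(\<Prod>k<N. 1 + z * p ^ Suc k) * (\<Prod>k<N. 1 + inverse z * p ^ k) =
     (\<Sum>i<Suc N. qbinom p (2 * N) (N + i) * (p ^ tri i * z ^ i)) +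
     (\<Sum>i<N. qbinom p (2 * N) (N - Suc i) * (p ^ tri i * inverse z ^ i)) / z"
proof -
  define x where "x = z / p ^ N"
  \<comment> \<open>the monomial pulled out of the first \<open>N\<close> factors\<close>
  define c where "c = z ^ N / p ^ tri (N - 1)"
  define f where "f j = qbinom p (2 * N) j * p ^ tri j * x ^ j" for j
  have c0: "c \<noteq> 0" using p z by (simp add: c_def)
  have "(\<Prod>k<2*N. 1 + x * p ^ Suc k) =
     (\<Prod>k<N. 1 + x * p ^ Suc k) * (\<Prod>k<N. 1 + x * p ^ Suc (N + k))"
    unfolding mult_2 by (rule prod_lessThan_add)
  also have "(\<Prod>k<N. 1 + x * p ^ Suc (N + k)) = (\<Prod>k<N. 1 + z * p ^ Suc k)"
    using p by (intro prod.cong) (auto simp: x_def power_add field_simps)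
  also have "(\<Prod>k<N. 1 + x * p ^ Suc k) = (\<Prod>k<N. 1 + x * p ^ Suc (N - Suc k))"
    by (rule prod.nat_diff_reindex[symmetric])
  also have "\<dots> = (\<Prod>k<N. (z / p ^ k) * (1 + inverse z * p ^ k))"
  proof (intro prod.cong refl)
    fix k assume "k \<in> {..<N}"
    then obtain m where m: "N = Suc k + m" using less_imp_Suc_add by auto
    show "1 + x * p ^ Suc (N - Suc k) = (z / p ^ k) * (1 + inverse z * p ^ k)"
      unfolding x_def m using p z by (simp add: power_add field_simps)
  qed
  also have "\<dots> = c * (\<Prod>k<N. 1 + inverse z * p ^ k)"
    unfolding prod.distrib prod_dividef prod_power_lessThan c_def by simp
  finally have lhs: "(\<Prod>k<2*N. 1 + x * p ^ Suc k) =
    c * ((\<Prod>k<N. 1 + z * p ^ Suc k) * (\<Prod>k<N. 1 + inverse z * p ^ k))"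
    by (simp add: mult_ac)
  have f_upper: "f (N + i) = c * (qbinom p (2 * N) (N + i) * (p ^ tri i * z ^ i))" for i
  proof -
    have "2 * (tri (N + i) + tri (N - 1)) = 2 * (tri i + N * (N + i))"
      unfolding distrib_left[of 2] two_tri by (cases N) (auto simp: algebra_simps)
    then have "tri (N + i) + tri (N - 1) = tri i + N * (N + i)"
      unfolding mult_cancel_left by simp
    then have "p ^ tri (N + i) * p ^ tri (N - 1) = p ^ tri i * (p ^ N) ^ (N + i)"
      unfolding power_add[symmetric] power_mult[symmetric] by (simp only:)
    then show ?thesis
      unfolding f_def c_def x_def using p by (simp add: divide_simps power_add)
  qed
  have f_lower: "f (N - Suc i) = c * (qbinom p (2 * N) (N - Suc i) * (p ^ tri i * inverse z ^ i) / z)"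
    if "i < N" for i
  proof -
    obtain m where m: "N = Suc i + m" using \<open>i < N\<close> less_imp_Suc_add by auto
    have [simp]: "N - Suc i = m" "N - 1 = i + m" using m by auto
    have "2 * (tri m + tri (N - 1)) = 2 * (tri i + N * m)"
      unfolding distrib_left[of 2] two_tri by (simp add: m algebra_simps)
    then have "tri m + tri (N - 1) = tri i + N * m"
      unfolding mult_cancel_left by simp
    then have e: "p ^ tri m * p ^ tri (N - 1) = p ^ tri i * (p ^ N) ^ m"
      unfolding power_add[symmetric] power_mult[symmetric] by (simp only:)
    have "z ^ m = z ^ N * inverse z ^ i / z"
      using z by (simp add: m power_add field_simps)
    then have "p ^ tri m * (z / p ^ N) ^ m = c * (p ^ tri i * inverse z ^ i / z)"
      unfolding c_def using e p z by (simp add: divide_simps) (simp add: algebra_simps)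
    then have "qbinom p (2 * N) m * (p ^ tri m * (z / p ^ N) ^ m) =
        qbinom p (2 * N) m * (c * (p ^ tri i * inverse z ^ i / z))" by (simp only:)
    then show ?thesis unfolding f_def x_def by (simp add: mult_ac)
  qed
  have "(\<Sum>j\<le>2*N. f j) = (\<Sum>j<N + Suc N. f j)"
    by (simp add: mult_2 lessThan_Suc_atMost)
  also have "\<dots> = (\<Sum>j<N. f j) + (\<Sum>i<Suc N. f (N + i))"
    by (rule sum_lessThan_add)
  also have "(\<Sum>j<N. f j) = (\<Sum>i<N. f (N - Suc i))"
    by (rule sum.nat_diff_reindex[symmetric])
  also have "\<dots> = c * ((\<Sum>i<N. qbinom p (2 * N) (N - Suc i) * (p ^ tri i * inverse z ^ i)) / z)"
    by (simp add: f_lower sum_distrib_left sum_divide_distrib)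
  also have "(\<Sum>i<Suc N. f (N + i)) =
      c * (\<Sum>i<Suc N. qbinom p (2 * N) (N + i) * (p ^ tri i * z ^ i))"
    unfolding f_upper sum_distrib_left ..
  finally have "c * ((\<Prod>k<N. 1 + z * p ^ Suc k) * (\<Prod>k<N. 1 + inverse z * p ^ k)) =
    c * ((\<Sum>i<Suc N. qbinom p (2 * N) (N + i) * (p ^ tri i * z ^ i)) +
     (\<Sum>i<N. qbinom p (2 * N) (N - Suc i) * (p ^ tri i * inverse z ^ i)) / z)"
    using qbinom_theorem[OF p(1), of x "2 * N"] lhs unfolding f_def
    by (simp only: distrib_left add.commute)
  with c0 show ?thesis by (simp only: mult_cancel_left) simp
qed

lemma q_product_limit:
  fixes p w :: complex
  assumes p: "norm p < 1" and nz: "\<And>k. 1 + w * p ^ k \<noteq> 0"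
  obtains L where "L \<noteq> 0" "(\<lambda>N. \<Prod>k<N. 1 + w * p ^ k) \<longlonglongrightarrow> L"
proof -
  have "summable (\<lambda>k. norm (1 + w * p ^ k - 1))"
    using p by (simp add: norm_mult norm_power summable_mult summable_geometric)
  then have conv: "convergent_prod (\<lambda>k. 1 + w * p ^ k)"
    by (intro abs_convergent_prod_imp_convergent_prod summable_imp_abs_convergent_prod)
  have "(\<lambda>N. \<Prod>k<Suc N. 1 + w * p ^ k) \<longlonglongrightarrow> prodinf (\<lambda>k. 1 + w * p ^ k)"
    using convergent_prod_LIMSEQ[OF conv] by (simp only: lessThan_Suc_atMost)
  then have "(\<lambda>N. \<Prod>k<N. 1 + w * p ^ k) \<longlonglongrightarrow> prodinf (\<lambda>k. 1 + w * p ^ k)"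
    by (rule LIMSEQ_imp_Suc)
  with prodinf_nonzero[OF conv nz] show thesis by (rule that)
qed

lemma qpoch_limit:
  assumes p: "norm p < 1"
  obtains L where "L \<noteq> 0" "qpoch p \<longlonglongrightarrow> L"
proof -
  have eq: "1 + (- p) * p ^ k = 1 - p ^ Suc k" for k by simp
  obtain L where "L \<noteq> 0" "(\<lambda>N. \<Prod>k<N. 1 + (- p) * p ^ k) \<longlonglongrightarrow> L"
    by (rule q_product_limit[OF p, of "- p"]) (unfold eq, rule one_minus_power_neq_0[OF p])
  moreover have "(\<lambda>N. \<Prod>k<N. 1 + (- p) * p ^ k) = qpoch p"
    unfolding eq by (simp add: qpoch_def fun_eq_iff)
  ultimately show thesis using that[of L] by simp
qed

lemma qbinom_bounded:
  assumes p: "norm p < 1"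
  shows "\<exists>C. \<forall>n j. norm (qbinom p n j) \<le> C"
proof -
  obtain L where L: "L \<noteq> 0" "qpoch p \<longlonglongrightarrow> L" by (rule qpoch_limit[OF p])
  have "Bseq (qpoch p)" by (rule convergent_imp_Bseq) (use L in \<open>auto simp: convergent_def\<close>)
  then obtain A where A: "A > 0" "\<And>n. norm (qpoch p n) \<le> A" by (auto simp: Bseq_def)
  have "Bseq (\<lambda>n. inverse (qpoch p n))"
    by (rule convergent_imp_Bseq) (use tendsto_inverse[OF L(2,1)] in \<open>auto simp: convergent_def\<close>)
  then obtain B where B: "B > 0" "\<And>n. norm (inverse (qpoch p n)) \<le> B" by (auto simp: Bseq_def)
  show ?thesis
  proof (intro exI allI)
    fix n j
    have "norm (qbinom p n j) =
      norm (qpoch p n) * (norm (inverse (qpoch p j)) * norm (inverse (qpoch p (n - j))))"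
      by (simp add: qbinom_def norm_mult norm_divide norm_inverse divide_inverse)
    also have "\<dots> \<le> A * (B * B)"
      by (intro mult_mono A B mult_nonneg_nonneg norm_ge_zero less_imp_le[OF A(1)] less_imp_le[OF B(1)])
    finally show "norm (qbinom p n j) \<le> A * (B * B)" .
  qed
qed

lemma qbinom_limit:
  assumes L: "L \<noteq> 0" "qpoch p \<longlonglongrightarrow> L"
    and f: "filterlim f at_top sequentially" "filterlim g at_top sequentially"
           "filterlim (\<lambda>N. f N - g N) at_top sequentially"
  shows "(\<lambda>N. qbinom p (f N) (g N)) \<longlonglongrightarrow> 1 / L"
proof -
  have "(\<lambda>N. qbinom p (f N) (g N)) \<longlonglongrightarrow> L / (L * L)"
    unfolding qbinom_def
    by (intro tendsto_intros filterlim_compose[OF L(2)] f) (use L in auto)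
  then show ?thesis using L by simp
qed

text \<open>
  Tannery's theorem for sums of growing length whose terms are a fixed summable sequence times
  uniformly bounded coefficients with a common limit.
\<close>

lemma tannery_finite_sum:
  fixes b :: "nat \<Rightarrow> complex" and c :: "nat \<Rightarrow> nat \<Rightarrow> complex"
  assumes lim: "\<And>k. (\<lambda>N. c k N) \<longlonglongrightarrow> l"
    and bd: "\<And>k N. norm (c k N) \<le> C"
    and b: "summable (\<lambda>k. norm (b k))"
    and m: "filterlim m at_top sequentially"
  shows "(\<lambda>N. \<Sum>k<m N. c k N * b k) \<longlonglongrightarrow> l * suminf b"
proof -
  define a where "a k N = (if k < m N then c k N * b k else 0)" for k N
  have C: "C \<ge> 0" using bd[of 0 0] norm_ge_zero order_trans by blast
  have "eventually (\<lambda>N. summable (\<lambda>k. norm (a k N))) sequentially \<and>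
       summable (\<lambda>k. norm (l * b k)) \<and> (\<lambda>N. suminf (\<lambda>k. a k N)) \<longlonglongrightarrow> suminf (\<lambda>k. l * b k)"
  proof (rule tannerys_theorem)
    fix k
    have "eventually (\<lambda>N. k < m N) sequentially"
      using m unfolding filterlim_at_top Suc_le_eq[symmetric] by blast
    then have "eventually (\<lambda>N. c k N * b k = a k N) sequentially"
      by eventually_elim (simp add: a_def)
    moreover have "(\<lambda>N. c k N * b k) \<longlonglongrightarrow> l * b k"
      by (intro tendsto_intros lim)
    ultimately show "(\<lambda>N. a k N) \<longlonglongrightarrow> l * b k"
      by (blast intro: Lim_transform_eventually)
  next
    have "norm (a k N) \<le> C * norm (b k)" for k N
      using C by (auto simp: a_def norm_mult intro!: mult_right_mono bd)
    then show "eventually (\<lambda>(k, N). norm (a k N) \<le> C * norm (b k)) (at_top \<times>\<^sub>F sequentially)"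
      by (intro always_eventually) auto
  next
    show "summable (\<lambda>k. C * norm (b k))" by (intro summable_mult b)
  qed simp
  then have "(\<lambda>N. suminf (\<lambda>k. a k N)) \<longlonglongrightarrow> suminf (\<lambda>k. l * b k)" by blast
  moreover have "suminf (\<lambda>k. a k N) = (\<Sum>k<m N. c k N * b k)" for N
    by (subst suminf_finite[of "{..<m N}"]) (auto simp: a_def)
  moreover have "suminf (\<lambda>k. l * b k) = l * suminf b"
    by (rule suminf_mult[OF summable_norm_cancel[OF b]])
  ultimately show ?thesis by simp
qed

text \<open>
  In the finite triple product the coefficients are bounded and tend to \<open>1 / (p; p)\<^sub>\<infinity>\<close>, so the
  right-hand side tends to \<open>qtheta q z / (p; p)\<^sub>\<infinity>\<close>. The left-hand side tends to a convergent
  infinite product, which vanishes only if one of its factors does.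
\<close>

lemma qtheta_nonzero:
  assumes q: "norm q > 1" and z: "z \<noteq> 0" and orbit: "\<And>n::int. z \<noteq> - (q powi n)"
  shows "qtheta q z \<noteq> 0"
proof -
  define p where "p = inverse q"
  have p: "norm p < 1" "p \<noteq> 0" and q0: "q \<noteq> 0"
    using q by (auto simp: p_def norm_inverse inverse_less_1_iff)
  have nz1: "1 + z * p * p ^ k \<noteq> 0" for k
  proof
    assume "1 + z * p * p ^ k = 0"
    then have "z * p ^ Suc k = -1" by (simp add: eq_neg_iff_add_eq_0 algebra_simps)
    then have "z = - (q powi int (Suc k))"
      using q0 unfolding p_def power_int_of_nat power_inverse by (simp add: field_simps)
    with orbit show False by blast
  qed
  have nz2: "1 + inverse z * p ^ k \<noteq> 0" for k
  proof
    assume "1 + inverse z * p ^ k = 0"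
    then have "z = - (p ^ k)" using z by (simp add: field_simps eq_neg_iff_add_eq_0)
    also have "p ^ k = q powi (- int k)" by (simp add: p_def power_int_minus power_inverse)
    finally show False using orbit by blast
  qed
  obtain P where P: "P \<noteq> 0" "(\<lambda>N. \<Prod>k<N. 1 + z * p * p ^ k) \<longlonglongrightarrow> P"
    by (rule q_product_limit[OF p(1) nz1])
  obtain Q where Q: "Q \<noteq> 0" "(\<lambda>N. \<Prod>k<N. 1 + inverse z * p ^ k) \<longlonglongrightarrow> Q"
    by (rule q_product_limit[OF p(1) nz2])
  obtain L where L: "L \<noteq> 0" "qpoch p \<longlonglongrightarrow> L" by (rule qpoch_limit[OF p(1)])
  obtain C where C: "\<And>n j. norm (qbinom p n j) \<le> C" using qbinom_bounded[OF p(1)] by blast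
  have lin: "filterlim (\<lambda>N. N - i) at_top sequentially" "filterlim (\<lambda>N. N + i) at_top sequentially"
    "filterlim (\<lambda>N. 2 * N) at_top sequentially" for i :: nat
    by (simp_all only: filterlim_at_top eventually_sequentially) presburger+
  have lim1: "(\<lambda>N. qbinom p (2 * N) (N + i)) \<longlonglongrightarrow> 1 / L" for i
    by (rule qbinom_limit[OF L lin(3) lin(2)]) (use lin(1)[of i] in \<open>simp add: mult_2\<close>)
  have lim2: "(\<lambda>N. qbinom p (2 * N) (N - Suc i)) \<longlonglongrightarrow> 1 / L" for i
  proof (rule qbinom_limit[OF L lin(3) lin(1)])
    show "filterlim (\<lambda>N. 2 * N - (N - Suc i)) at_top sequentially"
      by (rule filterlim_at_top_mono[OF filterlim_ident]) (auto intro!: always_eventually)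
  qed
  have "(\<lambda>N. (\<Prod>k<N. 1 + z * p ^ Suc k) * (\<Prod>k<N. 1 + inverse z * p ^ k)) \<longlonglongrightarrow>
      1 / L * half_theta p z + (1 / L * half_theta p (inverse z)) / z"
    unfolding finite_triple_product[OF p z] half_theta_def
    by (intro tendsto_intros tannery_finite_sum[where C = C] lim1 lim2 C summable_norm_half_theta
          p z filterlim_Suc filterlim_ident)
  also have "1 / L * half_theta p z + (1 / L * half_theta p (inverse z)) / z = qtheta q z / L"
    using qtheta_eq_half_theta[OF q z] by (simp add: p_def add_divide_distrib)
  finally have "(\<lambda>N. (\<Prod>k<N. 1 + z * p ^ Suc k) * (\<Prod>k<N. 1 + inverse z * p ^ k)) \<longlonglongrightarrow> qtheta q z / L" .
  moreover have "(\<lambda>N. (\<Prod>k<N. 1 + z * p ^ Suc k) * (\<Prod>k<N. 1 + inverse z * p ^ k)) \<longlonglongrightarrow> P * Q"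
    using tendsto_mult[OF P(2) Q(2)] by (simp add: mult.assoc)
  ultimately have "qtheta q z / L = P * Q" by (rule LIMSEQ_unique)
  with P Q show ?thesis by auto
qed

section \<open>Theta along the orbits of a proper germ\<close>

lemma qtheta_at_iterate:
  assumes q: "norm q > 1" and l: "l \<noteq> 0" and z: "z \<noteq> 0"
  shows "qtheta_at q l (z / q ^ n) = (l / z) ^ n * q ^ tri n * qtheta_at q l z"
proof (induction n)
  case (Suc n)
  have q0: "q \<noteq> 0" using q by auto
  define u where "u = z / q ^ Suc n / l"
  have u: "u \<noteq> 0" using z l q0 by (simp add: u_def)
  have "q * u = z / q ^ n / l" using q0 by (simp add: u_def)
  then have "qtheta_at q l (z / q ^ n) = u * qtheta_at q l (z / q ^ Suc n)"
    using qtheta_shift[OF q u] by (simp add: qtheta_at_def u_def)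
  then have "qtheta_at q l (z / q ^ Suc n) = qtheta_at q l (z / q ^ n) / u"
    using u by simp
  also have "\<dots> = (l / z) ^ Suc n * q ^ tri (Suc n) * qtheta_at q l z"
    unfolding Suc tri_Suc power_add u_def using z l q0 by (simp add: field_simps)
  finally show ?case .
qed simp

lemma isCont_qtheta_at:
  assumes q: "norm q > 1" and l: "l \<noteq> 0" and z: "z \<noteq> 0"
  shows "isCont (qtheta_at q l) z"
  unfolding qtheta_at_def
  by (rule isCont_o2[OF _ isCont_qtheta[OF q]]) (use l z in \<open>auto intro!: continuous_intros\<close>)

lemma qtheta_at_nonzero:
  assumes q: "norm q > 1" and l: "l \<noteq> 0" and z: "z \<noteq> 0"
    and orbit: "\<And>n::int. z \<noteq> - l * q powi n"
  shows "qtheta_at q l z \<noteq> 0"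
  unfolding qtheta_at_def
proof (rule qtheta_nonzero[OF q])
  show "z / l \<noteq> - (q powi n)" for n
    using orbit[of n] l by (auto simp: field_simps)
qed (use z l in auto)

lemma invariant_divide_power:
  fixes q :: complex
  assumes "\<forall>z\<in>W. z / q \<in> W" and "z \<in> W"
  shows "z / q ^ n \<in> W"
proof (induction n)
  case (Suc n)
  then have "(z / q ^ n) / q \<in> W" using assms by blast
  then show ?case by (simp add: divide_divide_eq_left mult.commute)
qed (use assms in simp)

lemma norm_divide_power_le:
  fixes q z :: complex
  assumes "norm q > 1"
  shows "norm (z / q ^ n) \<le> norm z"
proof -
  have "1 \<le> norm q ^ n" using assms by (intro one_le_power) simp
  then have "norm z / norm q ^ n \<le> norm z / 1" by (intro divide_left_mono) auto
  then show ?thesis by (simp add: norm_divide norm_power)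
qed

text \<open>
  If every orbit met \<open>W\<close>, then each point of the compact annulus \<open>1 \<le> norm z \<le> norm q\<close>, which
  meets every orbit, would have a neighbourhood carried into \<open>W\<close> by a power of \<open>q\<close> and, by
  invariance, by all smaller powers. Finitely many such neighbourhoods cover the annulus, so the
  smallest of their exponents works for all of it and \<open>W\<close> contains a punctured disc.
\<close>

lemma proper_germ_avoids_orbit:
  assumes q: "norm q > 1" and W: "proper_invariant_germ q W"
  obtains a where "a \<noteq> 0" "\<And>n::int. a * q powi n \<notin> W"
proof (rule ccontr)
  assume "\<not> thesis"
  with that have meets: "\<exists>n::int. a * q powi n \<in> W" if "a \<noteq> 0" for a using \<open>a \<noteq> 0\<close> by blast
  have q0: "q \<noteq> 0" using q by auto
  have opW: "open W" and inv: "\<forall>z\<in>W. z / q \<in> W"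
    and proper: "\<not> eventually (\<lambda>z. z \<in> W) (at 0)"
    using W by (auto simp: proper_invariant_germ_def)
  have down: "a * q powi m \<in> W" if "a * q powi n \<in> W" "m \<le> n" for a and m n :: int
  proof -
    have "a * q powi n / q ^ nat (n - m) \<in> W"
      by (rule invariant_divide_power[OF inv that(1)])
    moreover have "q powi n = q powi m * q ^ nat (n - m)"
      using q0 that(2) power_int_add[of q m "n - m"] by (simp flip: power_int_of_nat)
    ultimately show ?thesis using q0 by simp
  qed
  define A where "A = cball (0::complex) (norm q) - ball 0 1"
  have A: "compact A" "1 \<in> A" "0 \<notin> A" using q by (auto simp: A_def intro: compact_diff)
  then have "\<forall>a\<in>A. \<exists>n::int. a * q powi n \<in> W" using meets by metis
  then obtain e :: "complex \<Rightarrow> int" where e: "\<And>a. a \<in> A \<Longrightarrow> a * q powi e a \<in> W" by metis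
  have "open {w. w * q powi e a \<in> W}" for a
    using open_vimage[OF opW, of "\<lambda>w. w * q powi e a"] by (simp add: vimage_def continuous_intros)
  moreover have "A \<subseteq> (\<Union>a\<in>A. {w. w * q powi e a \<in> W})" using e by auto
  ultimately obtain D where D: "D \<subseteq> A" "finite D" "A \<subseteq> (\<Union>a\<in>D. {w. w * q powi e a \<in> W})"
    by (rule compactE_image[OF A(1), of A "\<lambda>a. {w. w * q powi e a \<in> W}"]) 
  define n0 where "n0 = Min (e ` D)"
  have inW: "w * q powi m \<in> W" if w: "w \<in> A" and m: "m \<le> n0" for w m
  proof -
    obtain a where a: "a \<in> D" "w * q powi e a \<in> W" using D(3) w by blast
    have "n0 \<le> e a" unfolding n0_def using D(2) a(1) by simp
    then show ?thesis using down[OF a(2)] m by simp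
  qed
  have "z \<in> W" if z: "z \<noteq> 0" "norm z < norm q powi n0" for z
  proof -
    define m where "m = \<lfloor>log (norm q) (norm z)\<rfloor>"
    have nz: "norm z = norm q powr (log (norm q) (norm z))"
      using q z by (subst powr_log_cancel) auto
    have "norm q powr m \<le> norm z"
      by (subst nz) (use q in \<open>simp add: m_def powr_mono\<close>)
    then have lo: "norm q powi m \<le> norm z" using q by (subst powr_real_of_int'[symmetric]) auto
    have "norm z < norm q powr real_of_int (m + 1)"
      by (subst nz, rule powr_less_mono) (use q in \<open>auto simp: m_def\<close>)
    also have "\<dots> = norm q powi (m + 1)"
      by (rule powr_real_of_int') (use q in auto)
    finally have hi: "norm z < norm q powi m * norm q"
      using q by (subst (asm) power_int_add_1) auto
    have "m \<le> n0"
    proof (rule ccontr)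
      assume "\<not> m \<le> n0"
      then have "norm q powi n0 \<le> norm q powi m" using q by (intro power_int_increasing) auto
      with lo z show False by linarith
    qed
    have "norm q powi m > 0" by (rule zero_less_power_int) (use q in auto)
    then have "z / q powi m \<in> A"
      using lo hi q by (auto simp: A_def norm_divide norm_power_int divide_simps mult.commute)
    from inW[OF this \<open>m \<le> n0\<close>] show ?thesis using q0 by simp
  qed
  moreover have "norm q powi n0 > 0" by (rule zero_less_power_int) (use q in auto)
  ultimately have "eventually (\<lambda>z. z \<in> W) (at 0)"
    unfolding eventually_at by (intro exI[of _ "norm q powi n0"]) auto
  with proper show False ..
qed

lemma power_int_power_swap: "(x ^ n) powi t = (x powi t) ^ n" for x :: real
  by (simp add: power_int_power power_int_power' mult.commute)

text \<open>
  Flatness made explicit along orbits: the functional equation expresses theta at \<open>w / q ^ n\<close>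
  through theta at \<open>w\<close>. The left-hand side keeps theta at \<open>w\<close> as a factor, so the bound also makes
  sense at zeros of theta, where it is void for \<open>t \<noteq> 0\<close>.
\<close>

lemma t_flat_orbit_bound:
  assumes q: "norm q > 1" and W: "0 \<notin> W" and f: "t_flat q W t f"
  obtains l where "l \<noteq> 0"
    "\<And>K. compact K \<Longrightarrow> K \<subseteq> W \<Longrightarrow> \<exists>C N n0. C \<ge> 0 \<and> (\<forall>n\<ge>n0. \<forall>w\<in>K.
       norm (f (w / q ^ n)) * (((norm l / norm w) powi t) ^ n * (norm q powi t) ^ tri n *
         norm (qtheta_at q l w) powi t) \<le> C * (norm q ^ n / norm w) ^ N)"
proof -
  from f obtain l where l: "l \<noteq> 0" and
    lK: "\<And>K. compact K \<Longrightarrow> K \<subseteq> W \<Longrightarrow> \<exists>N::nat. (\<lambda>z. norm (f z) * norm (qtheta_at q l z) powi t)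
            \<in> O[at 0 within q_orbit q K](\<lambda>z. norm z powi (- int N))"
    unfolding t_flat_def by blast
  show thesis
  proof (rule that[OF l])
    fix K assume K: "compact K" "K \<subseteq> W"
    obtain N :: nat where "(\<lambda>z. norm (f z) * norm (qtheta_at q l z) powi t)
            \<in> O[at 0 within q_orbit q K](\<lambda>z. norm z powi (- int N))"
      using lK[OF K] by blast
    then obtain C where C: "C > 0" and
      "eventually (\<lambda>z. norm (norm (f z) * norm (qtheta_at q l z) powi t) \<le>
         C * norm (norm z powi (- int N))) (at 0 within q_orbit q K)"
      by (auto elim!: landau_o.bigE)
    then obtain d where d: "d > 0" "\<And>z. z \<in> q_orbit q K \<Longrightarrow> z \<noteq> 0 \<Longrightarrow> norm z < d \<Longrightarrow>
        norm (f z) * norm (qtheta_at q l z) powi t \<le> C * norm z powi (- int N)"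
      unfolding eventually_at by (auto simp: abs_mult)
    obtain R where R: "R > 0" "\<And>w. w \<in> K \<Longrightarrow> norm w \<le> R"
      using compact_imp_bounded[OF K(1)] by (auto simp: bounded_pos)
    obtain n0 where n0: "R / d < norm q ^ n0" using real_arch_pow[OF q] by blast
    have "norm (f (w / q ^ n)) * (((norm l / norm w) powi t) ^ n * (norm q powi t) ^ tri n *
         norm (qtheta_at q l w) powi t) \<le> C * (norm q ^ n / norm w) ^ N"
      if n: "n \<ge> n0" and w: "w \<in> K" for n w
    proof -
      have w0: "w \<noteq> 0" and q0: "q \<noteq> 0" using w K W q by auto
      have "R / d < norm q ^ n"
        using n0 power_increasing[OF n, of "norm q"] q by linarith
      then have "norm w / norm q ^ n < d"
        using d R(2)[OF w] q0 by (simp add: field_simps)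
      then have "norm (f (w / q ^ n)) * norm (qtheta_at q l (w / q ^ n)) powi t
         \<le> C * norm (w / q ^ n) powi (- int N)"
        using w0 q0 w by (intro d) (auto simp: q_orbit_def norm_divide norm_power)
      also have "norm (w / q ^ n) powi (- int N) = (norm q ^ n / norm w) ^ N"
        by (simp add: norm_divide norm_power power_int_minus power_divide)
      also have "norm (qtheta_at q l (w / q ^ n)) powi t =
          ((norm l / norm w) powi t) ^ n * (norm q powi t) ^ tri n * norm (qtheta_at q l w) powi t"
        unfolding qtheta_at_iterate[OF q l w0] norm_mult norm_power norm_divide
          power_int_mult_distrib power_int_power_swap ..
      finally show ?thesis .
    qed
    with C show "\<exists>C N n0. C \<ge> 0 \<and> (\<forall>n\<ge>n0. \<forall>w\<in>K.
       norm (f (w / q ^ n)) * (((norm l / norm w) powi t) ^ n * (norm q powi t) ^ tri n *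
         norm (qtheta_at q l w) powi t) \<le> C * (norm q ^ n / norm w) ^ N)"
      using less_imp_le by blast
  qed
qed

section \<open>Flatness implies asymptotic flatness\<close>

lemma compact_continuous_bound:
  fixes h :: "complex \<Rightarrow> real"
  assumes "compact S" "continuous_on S h"
  obtains B where "B > 0" "\<And>w. w \<in> S \<Longrightarrow> h w \<le> B"
proof -
  have "bounded (h ` S)" using assms by (intro compact_imp_bounded compact_continuous_image)
  then obtain B where "B > 0" "\<And>w. w \<in> S \<Longrightarrow> norm (h w) \<le> B" by (auto simp: bounded_pos)
  then show thesis using that[of B] by (force simp: abs_le_iff)
qed

lemma gauss_weight_bounded:
  fixes r D :: real
  assumes "0 \<le> r" "r < 1"
  obtains M where "M > 0" "\<And>n. D ^ n * r ^ tri n \<le> M"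
proof -
  have "Bseq (\<lambda>n. D ^ n * r ^ tri n)"
    using gauss_weight_tendsto_0[OF assms, of D] by (intro convergent_imp_Bseq)
      (auto simp: convergent_def)
  then obtain M where "M > 0" "\<And>n. norm (D ^ n * r ^ tri n) \<le> M" by (auto simp: Bseq_def)
  then show thesis using that[of M] by (force simp: abs_le_iff)
qed

lemma circle_avoiding_countable:
  fixes w0 :: complex
  assumes "countable Z" "\<rho>0 > 0"
  obtains \<rho> where "0 < \<rho>" "\<rho> < \<rho>0" "sphere w0 \<rho> \<inter> Z = {}"
proof -
  have "uncountable ({0<..<\<rho>0} - (\<lambda>z. dist w0 z) ` Z)"
    using assms by (intro uncountable_minus_countable) (auto simp: uncountable_open_interval)
  then have "{0<..<\<rho>0} - (\<lambda>z. dist w0 z) ` Z \<noteq> {}" by (metis countable_empty)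
  then obtain \<rho> where "\<rho> \<in> {0<..<\<rho>0}" "\<rho> \<notin> (\<lambda>z. dist w0 z) ` Z" by blast
  then show thesis by (intro that[of \<rho>]) auto
qed

lemma orbit_power_mult:
  fixes x y :: real
  shows "(x ^ n / y) ^ M * (x ^ n / y) ^ N = (1 / y) ^ (M + N) * (x ^ (M + N)) ^ n"
proof -
  have "(x ^ n / y) ^ M * (x ^ n / y) ^ N = (x ^ n / y) ^ (M + N)"
    by (simp only: power_add)
  also have "\<dots> = (1 / y) ^ (M + N) * (x ^ n) ^ (M + N)"
    unfolding power_mult_distrib[symmetric] by simp
  also have "(x ^ n) ^ (M + N) = (x ^ (M + N)) ^ n"
    by (simp only: power_mult[symmetric] mult.commute)
  finally show ?thesis .
qed

text \<open>
  At the zeros of theta, \<open>t\<close>-flatness gives no information. But the zeros are countable, so some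
  small circle around \<open>w0\<close> avoids them; on it theta is bounded away from \<open>0\<close> and the decay of
  \<open>(norm q powi (- t)) ^ tri n\<close> wins against \<open>z powi (- m)\<close>. The maximum modulus principle carries the
  bound from the circle to the disc.
\<close>

lemma t_flat_bounded_near_point:
  assumes q: "norm q > 1" and W: "open W" "0 \<notin> W" "\<forall>z\<in>W. z / q \<in> W"
    and t: "t > 0" and hol: "f holomorphic_on W" and f: "t_flat q W t f" and w0: "w0 \<in> W"
  shows "\<exists>e>0. \<exists>M n0. \<forall>n\<ge>n0. \<forall>w\<in>ball w0 e.
           norm ((w / q ^ n) powi (- int m) * f (w / q ^ n)) \<le> M"
proof -
  have q0: "q \<noteq> 0" using q by auto
  obtain l where l: "l \<noteq> 0" and
    lK: "\<And>K. compact K \<Longrightarrow> K \<subseteq> W \<Longrightarrow> \<exists>C N n0. C \<ge> 0 \<and> (\<forall>n\<ge>n0. \<forall>w\<in>K.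
       norm (f (w / q ^ n)) * (((norm l / norm w) powi t) ^ n * (norm q powi t) ^ tri n *
         norm (qtheta_at q l w) powi t) \<le> C * (norm q ^ n / norm w) ^ N)"
    using t_flat_orbit_bound[OF q W(2) f] by blast
  obtain \<rho>0 where \<rho>0: "\<rho>0 > 0" "cball w0 \<rho>0 \<subseteq> W"
    using W(1) w0 open_contains_cball by blast
  obtain \<rho> where \<rho>: "0 < \<rho>" "\<rho> < \<rho>0" "sphere w0 \<rho> \<inter> range (\<lambda>n::int. - l * q powi n) = {}"
    by (rule circle_avoiding_countable[OF _ \<rho>0(1), of "range (\<lambda>n::int. - l * q powi n)" w0]) auto
  \<comment> \<open>Theta has no zeros on this circle, so the factors below are bounded uniformly on it.\<close>
  define S where "S = sphere w0 \<rho>"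
  have cb: "cball w0 \<rho> \<subseteq> W" using \<rho> \<rho>0 by auto
  have S: "compact S" "S \<subseteq> W" using cb by (auto simp: S_def)
  have S0: "w \<noteq> 0" if "w \<in> S" for w using S W that by auto
  have nz: "qtheta_at q l w \<noteq> 0" if "w \<in> S" for w
    by (rule qtheta_at_nonzero[OF q l S0[OF that]]) (use \<rho>(3) that in \<open>unfold S_def, blast\<close>)
  obtain C N n0 where C: "C \<ge> 0" and bd: "\<And>n w. n \<ge> n0 \<Longrightarrow> w \<in> S \<Longrightarrow>
       norm (f (w / q ^ n)) * (((norm l / norm w) powi t) ^ n * (norm q powi t) ^ tri n *
         norm (qtheta_at q l w) powi t) \<le> C * (norm q ^ n / norm w) ^ N"
    using lK[OF S] by blast
  have cth: "continuous_on S (qtheta_at q l)"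
    using isCont_qtheta_at[OF q l S0] by (blast intro: continuous_at_imp_continuous_on)
  obtain B1 where B1: "B1 > 0" "\<And>w. w \<in> S \<Longrightarrow> norm (qtheta_at q l w) powi (- t) \<le> B1"
    by (rule compact_continuous_bound[OF S(1), of "\<lambda>w. norm (qtheta_at q l w) powi (- t)"])
       (use nz in \<open>auto intro!: continuous_intros cth\<close>)
  obtain B2 where B2: "B2 > 0" "\<And>w. w \<in> S \<Longrightarrow> (norm w / norm l) powi t \<le> B2"
    by (rule compact_continuous_bound[OF S(1), of "\<lambda>w. (norm w / norm l) powi t"])
       (use l S0 in \<open>auto intro!: continuous_intros\<close>)
  obtain B3 where B3: "B3 > 0" "\<And>w. w \<in> S \<Longrightarrow> (1 / norm w) ^ (m + N) \<le> B3"
    by (rule compact_continuous_bound[OF S(1), of "\<lambda>w. (1 / norm w) ^ (m + N)"])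
       (use S0 in \<open>auto intro!: continuous_intros\<close>)
  define r where "r = norm q powi (- t)"
  have "norm q powi (- t) < norm q powi 0" by (rule power_int_strict_increasing) (use q t in auto)
  then have r: "0 \<le> r" "r < 1" by (auto simp: r_def)
  obtain M0 where M0: "M0 > 0" "\<And>n. (norm q ^ (m + N) * B2) ^ n * r ^ tri n \<le> M0"
    using gauss_weight_bounded[OF r, of "norm q ^ (m + N) * B2"] by blast
  define g where "g n w = (w / q ^ n) powi (- int m) * f (w / q ^ n)" for n w
  have onS: "norm (g n w) \<le> C * B3 * B1 * M0" if n: "n \<ge> n0" and w: "w \<in> S" for n w
  proof -
    note w0 = S0[OF w]
    define T where "T = norm (qtheta_at q l w)"
    have T: "T > 0" using nz[OF w] by (simp add: T_def)
    define u where "u = (norm l / norm w) powi t"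
    have u: "u > 0" using l w0 by (simp add: u_def)
    define s where "s = norm q powi t"
    have s: "s > 0" using q0 by (simp add: s_def)
    have "norm (f (w / q ^ n)) * (u ^ n * s ^ tri n * T powi t) \<le> C * (norm q ^ n / norm w) ^ N"
      using bd[OF n w] by (simp add: u_def s_def T_def)
    then have "norm (f (w / q ^ n)) \<le> C * (norm q ^ n / norm w) ^ N / (u ^ n * s ^ tri n * T powi t)"
      using u s T by (subst pos_le_divide_eq) auto
    also have "\<dots> = C * (norm q ^ n / norm w) ^ N * ((inverse u) ^ n * r ^ tri n * T powi (- t))"
      unfolding r_def s_def power_int_minus by (simp add: divide_inverse power_inverse)
    finally have f_le: "norm (f (w / q ^ n)) \<le>
        C * (norm q ^ n / norm w) ^ N * ((inverse u) ^ n * r ^ tri n * T powi (- t))" .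
    have "norm ((w / q ^ n) powi (- int m)) = (norm q ^ n / norm w) ^ m"
      by (simp add: norm_power_int norm_divide norm_power power_int_minus power_divide)
    then have "norm (g n w) = (norm q ^ n / norm w) ^ m * norm (f (w / q ^ n))"
      unfolding g_def norm_mult by simp
    also have "\<dots> \<le> (norm q ^ n / norm w) ^ m *
        (C * (norm q ^ n / norm w) ^ N * ((inverse u) ^ n * r ^ tri n * T powi (- t)))"
      by (rule mult_left_mono[OF f_le]) simp
    also have "\<dots> = C * ((norm q ^ n / norm w) ^ m * (norm q ^ n / norm w) ^ N) * (T powi (- t)) *
        (inverse u ^ n * r ^ tri n)"
      by (simp only: mult_ac)
    also have "(norm q ^ n / norm w) ^ m * (norm q ^ n / norm w) ^ N =
        (1 / norm w) ^ (m + N) * (norm q ^ (m + N)) ^ n"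
      by (rule orbit_power_mult)
    also have "C * ((1 / norm w) ^ (m + N) * (norm q ^ (m + N)) ^ n) * T powi (- t) *
        (inverse u ^ n * r ^ tri n) =
        (C * (1 / norm w) ^ (m + N) * T powi (- t)) * (((norm q ^ (m + N)) * inverse u) ^ n * r ^ tri n)"
      by (simp only: power_mult_distrib mult_ac)
    also have "\<dots> \<le> (C * B3 * B1) * ((norm q ^ (m + N) * B2) ^ n * r ^ tri n)"
    proof (rule mult_mono)
      have iu: "inverse u \<le> B2" using B2(2)[OF w] unfolding u_def power_int_inverse[symmetric] by simp
      show "(norm q ^ (m + N) * inverse u) ^ n * r ^ tri n \<le> (norm q ^ (m + N) * B2) ^ n * r ^ tri n"
        by (rule mult_right_mono[OF power_mono[OF mult_left_mono[OF iu]]]) (use u r in auto)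
      have "C * (1 / norm w) ^ (m + N) \<le> C * B3"
        by (rule mult_left_mono[OF B3(2)[OF w] C])
      then show "C * (1 / norm w) ^ (m + N) * T powi (- t) \<le> C * B3 * B1"
        unfolding T_def by (rule mult_mono[OF _ B1(2)[OF w]]) (use C B3 in auto)
      show "0 \<le> C * B3 * B1" using C B1 B3 by auto
      show "0 \<le> (norm q ^ (m + N) * inverse u) ^ n * r ^ tri n" using u r by auto
    qed
    also have "\<dots> \<le> C * B3 * B1 * M0"
      by (intro mult_left_mono M0) (use C B1 B3 in auto)
    finally show ?thesis .
  qed
  have hg: "g n holomorphic_on cball w0 \<rho>" for n
  proof -
    have "(\<lambda>w. f (w / q ^ n)) holomorphic_on cball w0 \<rho>"
      by (rule holomorphic_on_compose_gen[OF _ hol, unfolded o_def])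
        (use cb invariant_divide_power[OF W(3)] q0 in \<open>auto intro!: holomorphic_intros\<close>)
    moreover have "0 \<notin> cball w0 \<rho>" using cb W(2) by blast
    ultimately show ?thesis unfolding g_def[abs_def]
      using q0 by (auto intro!: holomorphic_intros)
  qed
  have "norm (g n w) \<le> C * B3 * B1 * M0" if "n \<ge> n0" "w \<in> ball w0 \<rho>" for n w
  proof (rule maximum_modulus_frontier[of "g n" "cball w0 \<rho>"])
    show "g n holomorphic_on interior (cball w0 \<rho>)"
      by (rule holomorphic_on_subset[OF hg interior_subset])
    show "continuous_on (closure (cball w0 \<rho>)) (g n)"
      using holomorphic_on_imp_continuous_on[OF hg] by simp
    show "norm (g n z) \<le> C * B3 * B1 * M0" if "z \<in> frontier (cball w0 \<rho>)" for z
      using onS[OF \<open>n \<ge> n0\<close>, of z] that by (simp add: S_def)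
  qed (use that in auto)
  then show ?thesis unfolding g_def using \<rho>(1) by blast
qed

text \<open>
  Compactness gives a common threshold \<open>n1\<close> for the preceding local bounds; the remaining finitely
  many translates of \<open>K\<close> are compact.
\<close>

lemma t_flat_imp_asymp_flat:
  assumes q: "norm q > 1" and W: "open W" "0 \<notin> W" "\<forall>z\<in>W. z / q \<in> W"
    and t: "t > 0" and hol: "f holomorphic_on W" and f: "t_flat q W t f"
  shows "asymp_flat q W f"
  unfolding asymp_flat_def
proof (intro allI impI, elim conjE)
  fix m :: nat and K assume K: "compact K" "K \<subseteq> W"
  have q0: "q \<noteq> 0" using q by auto
  define g where "g n w = (w / q ^ n) powi (- int m) * f (w / q ^ n)" for n w
  have "\<forall>w0\<in>W. \<exists>e M n0. e > 0 \<and> (\<forall>n\<ge>n0. \<forall>w\<in>ball w0 e. norm (g n w) \<le> M)"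
    using t_flat_bounded_near_point[OF q W t hol f, of _ m] unfolding g_def by blast
  then obtain e M n0 where e: "\<And>w0. w0 \<in> W \<Longrightarrow> e w0 > 0" and
    bd: "\<And>w0 n w. w0 \<in> W \<Longrightarrow> n \<ge> n0 w0 \<Longrightarrow> w \<in> ball w0 (e w0) \<Longrightarrow> norm (g n w) \<le> (M w0 :: real)"
    by metis
  obtain D where D: "D \<subseteq> K" "finite D" "K \<subseteq> (\<Union>w0\<in>D. ball w0 (e w0))"
    by (rule compactE_image[OF K(1), of K "\<lambda>w0. ball w0 (e w0)"]) (use e K in force)+
  define n1 where "n1 = Max (insert 0 (n0 ` D))"
  define M1 where "M1 = Max (insert 0 (M ` D))"
  have tail: "norm (g n w) \<le> M1" if n: "n \<ge> n1" and w: "w \<in> K" for n w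
  proof -
    obtain w0 where w0: "w0 \<in> D" "w \<in> ball w0 (e w0)" using D(3) w by blast
    have "n0 w0 \<le> n1" "M w0 \<le> M1" using D w0 by (auto simp: n1_def M1_def)
    then show ?thesis using bd[of w0 n w] w0 D K n by force
  qed
  have head: "bounded (g n ` K)" for n
  proof -
    have "continuous_on K (\<lambda>w. f (w / q ^ n))"
      by (rule continuous_on_compose2[OF holomorphic_on_imp_continuous_on[OF hol]])
        (use invariant_divide_power[OF W(3)] K q0 in \<open>auto intro!: continuous_intros\<close>)
    moreover have "0 \<notin> K" using K W by blast
    ultimately have "continuous_on K (g n)"
      unfolding g_def using q0 by (auto intro!: continuous_intros)
    then show ?thesis using K by (intro compact_imp_bounded compact_continuous_image)
  qed
  have "bounded (cball 0 M1 \<union> (\<Union>n<n1. g n ` K))"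
    by (intro iffD2[OF bounded_Un] conjI bounded_cball bounded_UN ballI head finite_lessThan)
  moreover have "(\<lambda>z. z powi (- int m) * f z) ` q_orbit q K \<subseteq> cball 0 M1 \<union> (\<Union>n<n1. g n ` K)"
  proof (rule image_subsetI)
    fix z assume "z \<in> q_orbit q K"
    then obtain w n where w: "w \<in> K" and z: "z = w / q ^ n" unfolding q_orbit_def by blast
    have eq: "z powi (- int m) * f z = g n w" by (simp add: z g_def)
    show "z powi (- int m) * f z \<in> cball 0 M1 \<union> (\<Union>n<n1. g n ` K)"
    proof (cases "n < n1")
      case True
      then show ?thesis unfolding eq using w by blast
    next
      case False
      then have "n1 \<le> n" by simp
      from tail[OF this w] show ?thesis unfolding eq by simp
    qed
  qed
  ultimately show "bounded ((\<lambda>z. z powi (- int m) * f z) ` q_orbit q K)"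
    by (rule bounded_subset)
qed

section \<open>Growth of solutions of pure systems along orbits\<close>

text \<open>
  A moderate growth condition at \<open>0\<close>. Only an upper bound is required, since it is applied to norms.
\<close>

definition poly_growth :: "(complex \<Rightarrow> real) \<Rightarrow> bool" where
  "poly_growth h \<longleftrightarrow> (\<exists>C N. C \<ge> 0 \<and> (\<forall>\<^sub>F z in at 0. h z \<le> C * (1 / norm z) ^ N))"

lemma eventually_one_le_inverse_norm:
  "\<forall>\<^sub>F z in at (0::complex). 1 \<le> 1 / norm z"
  unfolding eventually_at by (intro exI[of _ 1]) auto

lemma poly_growth_add:
  assumes "poly_growth f" "poly_growth g"
  shows "poly_growth (\<lambda>z. f z + g z)"
proof -
  obtain C N where C: "C \<ge> 0" "\<forall>\<^sub>F z in at 0. f z \<le> C * (1 / norm z) ^ N"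
    using assms(1) by (auto simp: poly_growth_def)
  obtain D M where D: "D \<ge> 0" "\<forall>\<^sub>F z in at 0. g z \<le> D * (1 / norm z) ^ M"
    using assms(2) by (auto simp: poly_growth_def)
  have "\<forall>\<^sub>F z in at 0. f z + g z \<le> (C + D) * (1 / norm z) ^ (N + M)"
    using C(2) D(2) eventually_one_le_inverse_norm
  proof eventually_elim
    case (elim z)
    have "C * (1 / norm z) ^ N \<le> C * (1 / norm z) ^ (N + M)"
      by (intro mult_left_mono power_increasing C) (use elim in auto)
    moreover have "D * (1 / norm z) ^ M \<le> D * (1 / norm z) ^ (N + M)"
      by (intro mult_left_mono power_increasing D) (use elim in auto)
    ultimately show ?case using elim unfolding distrib_right by linarith
  qed
  with C(1) D(1) show ?thesis unfolding poly_growth_def by (intro exI[of _ "C + D"]) auto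
qed

lemma poly_growth_sum:
  assumes "finite I" "\<And>i. i \<in> I \<Longrightarrow> poly_growth (f i)"
  shows "poly_growth (\<lambda>z. \<Sum>i\<in>I. f i z)"
  using assms
proof (induction I)
  case empty
  show ?case unfolding poly_growth_def by (intro exI[of _ 0]) simp
next
  case (insert i I)
  then show ?case by (simp add: poly_growth_add)
qed

text \<open>
  Near \<open>0\<close> the function is \<open>z powi k\<close> times a convergent power series, which is bounded there.
\<close>

lemma meromorphic_poly_growth:
  assumes "f meromorphic_on {0}"
  shows "poly_growth (\<lambda>z. norm (f z))"
proof -
  obtain L where L: "f has_laurent_expansion L"
    using assms by (auto simp: meromorphic_on_def)
  define P where "P = fls_base_factor_to_fps L"
  have r: "fps_conv_radius P > 0" and ev: "\<forall>\<^sub>F z in at 0. eval_fls L z = f z"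
    using L by (auto simp: has_laurent_expansion_def P_def fls_conv_radius_altdef)
  have "isCont (eval_fps P) 0"
    by (rule continuous_eval_fps) (use r in \<open>simp add: zero_ereal_def\<close>)
  then have "(eval_fps P \<longlongrightarrow> eval_fps P 0) (at 0)" by (simp add: isCont_def)
  then have "\<forall>\<^sub>F z in at 0. norm (eval_fps P z) < norm (eval_fps P 0) + 1"
    by (intro order_tendstoD(2)[OF tendsto_norm]) auto
  then have "\<forall>\<^sub>F z in at 0. norm (f z) \<le>
     (norm (eval_fps P 0) + 1) * (1 / norm z) ^ nat (- fls_subdegree L)"
    using ev eventually_one_le_inverse_norm
  proof eventually_elim
    case (elim z)
    then have "norm z \<noteq> 0" by auto
    with elim have z: "0 < norm z" "norm z \<le> 1" by (auto simp: field_simps)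
    have "norm z powi fls_subdegree L \<le> norm z powi (- int (nat (- fls_subdegree L)))"
      by (rule power_int_decreasing) (use z in auto)
    also have "\<dots> = (1 / norm z) ^ nat (- fls_subdegree L)"
      unfolding power_int_minus power_int_of_nat by (simp add: inverse_eq_divide power_one_over)
    finally have "norm (eval_fps P z) * norm z powi fls_subdegree L \<le>
        (norm (eval_fps P 0) + 1) * (1 / norm z) ^ nat (- fls_subdegree L)"
      using elim by (intro mult_mono) auto
    moreover have "norm (f z) = norm (eval_fps P z) * norm z powi fls_subdegree L"
      using elim by (metis P_def eval_fls_def norm_mult norm_power_int)
    ultimately show ?case by simp
  qed
  then show ?thesis unfolding poly_growth_def by (intro exI[of _ "norm (eval_fps P 0) + 1"]) auto
qed

lemma norm_matrix_vector_le:
  fixes M :: "complex ^ 'n ^ 'm"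
  shows "norm (M *v v) \<le> (\<Sum>i\<in>UNIV. \<Sum>j\<in>UNIV. norm (M $ i $ j)) * norm v"
proof -
  have "norm (M *v v) \<le> (\<Sum>i\<in>UNIV. norm ((M *v v) $ i))"
    unfolding norm_vec_def by (rule L2_set_le_sum) simp
  also have "\<dots> \<le> (\<Sum>i\<in>UNIV. \<Sum>j\<in>UNIV. norm (M $ i $ j) * norm v)"
  proof (rule sum_mono)
    fix i
    have "norm ((M *v v) $ i) \<le> (\<Sum>j\<in>UNIV. norm (M $ i $ j * v $ j))"
      unfolding matrix_vector_mult_def by (simp add: norm_sum)
    also have "\<dots> \<le> (\<Sum>j\<in>UNIV. norm (M $ i $ j) * norm v)"
      by (intro sum_mono) (simp add: norm_mult mult_left_mono Finite_Cartesian_Product.norm_nth_le)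
    finally show "norm ((M *v v) $ i) \<le> (\<Sum>j\<in>UNIV. norm (M $ i $ j) * norm v)" .
  qed
  also have "\<dots> = (\<Sum>i\<in>UNIV. \<Sum>j\<in>UNIV. norm (M $ i $ j)) * norm v"
    by (simp add: sum_distrib_right)
  finally show ?thesis .
qed

lemma merom_germ_matrix_growth:
  fixes F :: "complex \<Rightarrow> complex ^ 'n ^ 'n"
  assumes "merom_germ_matrix F"
  shows "\<exists>C N. C \<ge> 0 \<and> (\<forall>\<^sub>F z in at 0. \<forall>v. norm (F z *v v) \<le> C * (1 / norm z) ^ N * norm v)"
proof -
  have "poly_growth (\<lambda>z. \<Sum>i\<in>UNIV. \<Sum>j\<in>UNIV. norm (F z $ i $ j))"
    using assms unfolding merom_germ_matrix_def
    by (intro poly_growth_sum meromorphic_poly_growth) auto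
  then obtain C N where C: "C \<ge> 0"
    "\<forall>\<^sub>F z in at 0. (\<Sum>i\<in>UNIV. \<Sum>j\<in>UNIV. norm (F z $ i $ j)) \<le> C * (1 / norm z) ^ N"
    unfolding poly_growth_def by blast
  have "\<forall>\<^sub>F z in at 0. \<forall>v. norm (F z *v v) \<le> C * (1 / norm z) ^ N * norm v"
    using C(2)
  proof eventually_elim
    case (elim z)
    show ?case
      using order_trans[OF norm_matrix_vector_le mult_right_mono[OF elim norm_ge_zero]] by blast
  qed
  with C(1) show ?thesis by blast
qed

lemma matrix_inv_eqI:
  fixes A B :: "'a :: semiring_1 ^ 'n ^ 'n"
  assumes "A ** B = mat 1" "B ** A = mat 1"
  shows "matrix_inv A = B"
proof -
  have "\<exists>A'. A ** A' = mat 1 \<and> A' ** A = mat 1" using assms by blast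
  then have *: "A ** matrix_inv A = mat 1 \<and> matrix_inv A ** A = mat 1"
    unfolding matrix_inv_def by (rule someI_ex)
  have "matrix_inv A = matrix_inv A ** (A ** B)" using assms by simp
  also have "\<dots> = B" unfolding matrix_mul_assoc using * by simp
  finally show ?thesis .
qed

lemma norm_scaled_matrix_vector:
  fixes A :: "complex ^ 'n ^ 'm"
  shows "norm ((\<chi> i j. c * A $ i $ j) *v v) = norm c * norm (A *v v)"
proof -
  have "((\<chi> i j. c * A $ i $ j) *v v) = (\<chi> i. c * (A *v v) $ i)"
    by (simp add: vec_eq_iff matrix_vector_mult_def sum_distrib_left mult.assoc)
  then show ?thesis
    by (simp add: norm_vec_def norm_mult L2_set_right_distrib)
qed

text \<open>
  The gauge transformation \<open>X = F Y\<close> turns the system into \<open>Y (q z) = z powi (- \<mu>) A Y z\<close>. Since \<open>F\<close>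
  and its inverse \<open>G\<close> are meromorphic at \<open>0\<close>, \<open>X\<close> and \<open>Y\<close> differ by at most a power of \<open>norm z\<close>. Because
  \<open>A\<close> is invertible, the new equation bounds \<open>Y\<close> at \<open>z\<close> and at \<open>z / q\<close> by each other. The radius
  \<open>\<delta>\<close> is the same for all orbits, so that a statement about germs can be checked orbit by orbit.
\<close>

lemma pure_solution_gauge:
  fixes B :: "complex \<Rightarrow> complex ^ 'n ^ 'n" and X :: "complex \<Rightarrow> complex ^ 'n"
  assumes q: "norm q > 1" and inv: "\<forall>z\<in>W. z / q \<in> W"
    and pure: "pure_system q \<mu> B" and sol: "solves_system q W B X"
  obtains Y :: "complex \<Rightarrow> complex ^ 'n" and a b \<delta> C :: real and N :: nat
  where "\<delta> > 0" "a > 0" "b > 0" "C > 0"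
    "\<And>z. z \<in> W \<Longrightarrow> z \<noteq> 0 \<Longrightarrow> norm z < \<delta> \<Longrightarrow> norm (X z) \<le> C * (1 / norm z) ^ N * norm (Y z)"
    "\<And>z. z \<in> W \<Longrightarrow> z \<noteq> 0 \<Longrightarrow> norm z < \<delta> \<Longrightarrow> norm (Y z) \<le> C * (1 / norm z) ^ N * norm (X z)"
    "\<And>z. z \<in> W \<Longrightarrow> z \<noteq> 0 \<Longrightarrow> norm z < \<delta> \<Longrightarrow> norm (Y z) \<le> a * norm (z / q) powi (- \<mu>) * norm (Y (z / q))"
    "\<And>z. z \<in> W \<Longrightarrow> z \<noteq> 0 \<Longrightarrow> norm z < \<delta> \<Longrightarrow> norm (Y (z / q)) \<le> b * norm (z / q) powi \<mu> * norm (Y z)"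
proof -
  obtain F A where F: "GL_germ F" and A: "invertible A" and
    B: "\<forall>\<^sub>F z in at 0. B z = F (q * z) ** (\<chi> i j. z powi (- \<mu>) * A $ i $ j) ** matrix_inv (F z)"
    using pure unfolding pure_system_def by blast
  obtain G where mF: "merom_germ_matrix F" and mG: "merom_germ_matrix G" and
    FG: "\<forall>\<^sub>F z in at 0. F z ** G z = mat 1 \<and> G z ** F z = mat 1"
    using F unfolding GL_germ_def by blast
  obtain A' where A': "A' ** A = mat 1"
    using A unfolding invertible_def by blast
  obtain CF NF where CF: "CF \<ge> 0"
    "\<forall>\<^sub>F z in at 0. \<forall>v. norm (F z *v v) \<le> CF * (1 / norm z) ^ NF * norm v"
    using merom_germ_matrix_growth[OF mF] by blast
  obtain CG NG where CG: "CG \<ge> 0"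
    "\<forall>\<^sub>F z in at 0. \<forall>v. norm (G z *v v) \<le> CG * (1 / norm z) ^ NG * norm v"
    using merom_germ_matrix_growth[OF mG] by blast
  have sol': "\<forall>\<^sub>F z in at 0. q * z \<in> W \<longrightarrow> X (q * z) = B z *v X z"
    using sol unfolding solves_system_def eventually_at_filter by (auto elim!: eventually_mono)
  have "\<forall>\<^sub>F z in at 0. 1 \<le> 1 / norm z \<and>
      B z = F (q * z) ** (\<chi> i j. z powi (- \<mu>) * A $ i $ j) ** matrix_inv (F z) \<and>
      F z ** G z = mat 1 \<and> G z ** F z = mat 1 \<and>
      (\<forall>v. norm (F z *v v) \<le> CF * (1 / norm z) ^ NF * norm v) \<and>
      (\<forall>v. norm (G z *v v) \<le> CG * (1 / norm z) ^ NG * norm v) \<and>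
      (q * z \<in> W \<longrightarrow> X (q * z) = B z *v X z)"
    using eventually_one_le_inverse_norm B FG CF(2) CG(2) sol' by eventually_elim blast
  then obtain \<delta> where \<delta>: "\<delta> > 0" and near: "\<And>z. z \<noteq> 0 \<Longrightarrow> norm z < \<delta> \<Longrightarrow>
      1 \<le> 1 / norm z \<and>
      B z = F (q * z) ** (\<chi> i j. z powi (- \<mu>) * A $ i $ j) ** matrix_inv (F z) \<and>
      F z ** G z = mat 1 \<and> G z ** F z = mat 1 \<and>
      (\<forall>v. norm (F z *v v) \<le> CF * (1 / norm z) ^ NF * norm v) \<and>
      (\<forall>v. norm (G z *v v) \<le> CG * (1 / norm z) ^ NG * norm v) \<and>
      (q * z \<in> W \<longrightarrow> X (q * z) = B z *v X z)"
    unfolding eventually_at by auto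
  \<comment> \<open>One pair \<open>C, N\<close> serves both \<open>F\<close> and \<open>G\<close>; the summand \<open>1\<close> keeps \<open>a\<close> and \<open>b\<close> positive.\<close>
  define Y where "Y z = G z *v X z" for z
  define C where "C = max 1 (max CF CG)"
  define N where "N = max NF NG"
  define a where "a = (\<Sum>i\<in>UNIV. \<Sum>j\<in>UNIV. norm (A $ i $ j)) + 1"
  define b where "b = (\<Sum>i\<in>UNIV. \<Sum>j\<in>UNIV. norm (A' $ i $ j)) + 1"
  have a: "a > 0" "norm (A *v v) \<le> a * norm v" for v
    using norm_matrix_vector_le[of A v]
    by (auto simp: a_def distrib_right intro!: add_nonneg_pos sum_nonneg intro: add_increasing2)
  have b: "b > 0" "norm v \<le> b * norm (A *v v)" for v
    using norm_matrix_vector_le[of A' "A *v v"] A'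
    by (auto simp: b_def distrib_right matrix_vector_mul_assoc intro!: add_nonneg_pos sum_nonneg
             intro: add_increasing2)
  have weaken: "D * (1 / norm z) ^ M * s \<le> C * (1 / norm z) ^ N * s"
    if "D \<le> C" "M \<le> N" "1 \<le> 1 / norm z" "s \<ge> 0" for D M s and z :: complex
    using that by (intro mult_right_mono mult_mono power_increasing) (auto simp: C_def)
  have one: "norm (Y z) = norm (z / q) powi (- \<mu>) * norm (A *v Y (z / q))"
    if z: "z \<in> W" "z \<noteq> 0" "norm z < \<delta>" for z
  proof -
    have q0: "q \<noteq> 0" using q by auto
    define w where "w = z / q"
    have w: "w \<noteq> 0" "q * w = z" using z q0 by (auto simp: w_def)
    have "norm w \<le> norm z" using q z by (simp add: w_def norm_divide divide_simps)
    then have wd: "norm w < \<delta>" using z by simp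
    note nw = near[OF w(1) wd]
    note nz = near[OF z(2,3)]
    have "matrix_inv (F w) = G w" by (rule matrix_inv_eqI) (use nw in auto)
    moreover have "X z = B w *v X w" using nw w z by simp
    ultimately have "X z = F z ** (\<chi> i j. w powi (- \<mu>) * A $ i $ j) ** G w *v X w"
      using nw w by simp
    then have "Y z = (G z ** F z) *v ((\<chi> i j. w powi (- \<mu>) * A $ i $ j) *v Y w)"
      by (simp add: Y_def matrix_vector_mul_assoc matrix_mul_assoc)
    also have "\<dots> = (\<chi> i j. w powi (- \<mu>) * A $ i $ j) *v Y w" using nz by simp
    finally have e: "Y z = (\<chi> i j. w powi (- \<mu>) * A $ i $ j) *v Y w" .
    show ?thesis unfolding e norm_scaled_matrix_vector norm_power_int w_def ..
  qed
  show thesis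
  proof (rule that[OF \<delta> a(1) b(1)])
    show "C > 0" by (simp add: C_def)
  next
    fix z assume z: "z \<in> W" "z \<noteq> 0" "norm z < \<delta>"
    note nz = near[OF z(2,3)]
    have "X z = F z *v Y z" using nz by (simp add: Y_def matrix_vector_mul_assoc)
    then have "norm (X z) \<le> CF * (1 / norm z) ^ NF * norm (Y z)" using nz by simp
    also have "\<dots> \<le> C * (1 / norm z) ^ N * norm (Y z)"
      by (rule weaken) (use nz in \<open>auto simp: C_def N_def\<close>)
    finally show "norm (X z) \<le> C * (1 / norm z) ^ N * norm (Y z)" .
    have "norm (Y z) \<le> CG * (1 / norm z) ^ NG * norm (X z)" using nz by (simp add: Y_def)
    also have "\<dots> \<le> C * (1 / norm z) ^ N * norm (X z)"
      by (rule weaken) (use nz in \<open>auto simp: C_def N_def\<close>)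
    finally show "norm (Y z) \<le> C * (1 / norm z) ^ N * norm (X z)" .
    define u where "u = norm (z / q) powi (- \<mu>)"
    have "z / q \<noteq> 0" using z q by auto
    then have u: "u > 0" unfolding u_def by (intro zero_less_power_int) simp
    have "norm (Y z) = u * norm (A *v Y (z / q))" using one[OF z] by (simp add: u_def)
    also have "\<dots> \<le> u * (a * norm (Y (z / q)))"
      by (rule mult_left_mono[OF a(2)]) (use u in simp)
    finally show "norm (Y z) \<le> a * norm (z / q) powi (- \<mu>) * norm (Y (z / q))"
      by (simp add: u_def mult_ac)
    have "norm (z / q) powi \<mu> = inverse u" by (simp add: u_def power_int_minus)
    moreover have "norm (A *v Y (z / q)) = inverse u * norm (Y z)"
      using one[OF z, folded u_def] u by simp
    ultimately have "norm (A *v Y (z / q)) = norm (z / q) powi \<mu> * norm (Y z)" by simp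
    then show "norm (Y (z / q)) \<le> b * norm (z / q) powi \<mu> * norm (Y z)"
      using b(2)[of "Y (z / q)"] by (simp add: mult.assoc)
  qed
qed

text \<open>
  Iterating the two comparisons along the orbit. The factors \<open>norm (z / q ^ k) powi \<mu>\<close> multiply to
  \<open>norm z powi (n \<mu>)\<close> times the \<open>tri n\<close>-th power of \<open>norm q powi (- \<mu>)\<close>, which is the weight by which
  theta to the power \<open>- \<mu>\<close> changes.
\<close>

lemma pure_solution_orbit:
  fixes B :: "complex \<Rightarrow> complex ^ 'n ^ 'n" and X :: "complex \<Rightarrow> complex ^ 'n"
  assumes q: "norm q > 1" and W: "0 \<notin> W" "\<forall>z\<in>W. z / q \<in> W"
    and pure: "pure_system q \<mu> B" and sol: "solves_system q W B X"
  obtains Y :: "complex \<Rightarrow> complex ^ 'n" and a b \<delta> C :: real and N :: nat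
  where "\<delta> > 0" "a > 0" "b > 0" "C > 0"
    "\<And>z. z \<in> W \<Longrightarrow> norm z < \<delta> \<Longrightarrow> norm (X z) \<le> C * (1 / norm z) ^ N * norm (Y z)"
    "\<And>z. z \<in> W \<Longrightarrow> norm z < \<delta> \<Longrightarrow> norm (Y z) \<le> C * (1 / norm z) ^ N * norm (X z)"
    "\<And>z n. z \<in> W \<Longrightarrow> norm z < \<delta> \<Longrightarrow>
       norm (Y z) \<le> (a * norm z powi (- \<mu>)) ^ n * (norm q powi \<mu>) ^ tri n * norm (Y (z / q ^ n))"
    "\<And>z n. z \<in> W \<Longrightarrow> norm z < \<delta> \<Longrightarrow>
       norm (Y (z / q ^ n)) \<le> (b * norm z powi \<mu>) ^ n * (norm q powi (- \<mu>)) ^ tri n * norm (Y z)"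
proof (rule pure_solution_gauge[OF q W(2) pure sol])
  fix Y :: "complex \<Rightarrow> complex ^ 'n" and a b \<delta> C :: real and N :: nat
  assume pos: "\<delta> > 0" "a > 0" "b > 0" "C > 0" and
    XY: "\<And>z. z \<in> W \<Longrightarrow> z \<noteq> 0 \<Longrightarrow> norm z < \<delta> \<Longrightarrow> norm (X z) \<le> C * (1 / norm z) ^ N * norm (Y z)" and
    YX: "\<And>z. z \<in> W \<Longrightarrow> z \<noteq> 0 \<Longrightarrow> norm z < \<delta> \<Longrightarrow> norm (Y z) \<le> C * (1 / norm z) ^ N * norm (X z)" and
    up: "\<And>z. z \<in> W \<Longrightarrow> z \<noteq> 0 \<Longrightarrow> norm z < \<delta> \<Longrightarrow> norm (Y z) \<le> a * norm (z / q) powi (- \<mu>) * norm (Y (z / q))" and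
    dn: "\<And>z. z \<in> W \<Longrightarrow> z \<noteq> 0 \<Longrightarrow> norm z < \<delta> \<Longrightarrow> norm (Y (z / q)) \<le> b * norm (z / q) powi \<mu> * norm (Y z)"
  have q0: "q \<noteq> 0" using q by auto
  have orb: "z / q ^ n \<in> W" "z / q ^ n \<noteq> 0" "norm (z / q ^ n) < \<delta>" "z / q ^ n / q = z / q ^ Suc n"
    if z: "z \<in> W" "norm z < \<delta>" for z n
  proof -
    show inW: "z / q ^ n \<in> W" by (rule invariant_divide_power[OF W(2) z(1)])
    then show "z / q ^ n \<noteq> 0" using W(1) by metis
    show "norm (z / q ^ n) < \<delta>" using norm_divide_power_le[OF q, of z n] z(2) by linarith
  qed (simp add: mult.commute)
  have weight: "norm (z / q ^ Suc n) powi k = norm z powi k * (norm q powi (- k)) ^ Suc n" for z n k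
  proof -
    have "norm (z / q ^ Suc n) = norm z * inverse (norm q) ^ Suc n"
      unfolding divide_inverse norm_mult norm_inverse norm_power power_inverse ..
    then show ?thesis
      by (simp only: power_int_mult_distrib power_int_power_swap power_int_inverse power_int_minus)
  qed
  have up_n: "norm (Y z) \<le> (a * norm z powi (- \<mu>)) ^ n * (norm q powi \<mu>) ^ tri n * norm (Y (z / q ^ n))"
    if z: "z \<in> W" "norm z < \<delta>" for z n
  proof (induction n)
    case (Suc n)
    define K where "K = (a * norm z powi (- \<mu>)) ^ n * (norm q powi \<mu>) ^ tri n"
    have K: "K \<ge> 0" using pos by (simp add: K_def)
    have "norm (Y (z / q ^ n)) \<le>
        a * (norm z powi (- \<mu>) * (norm q powi \<mu>) ^ Suc n) * norm (Y (z / q ^ Suc n))"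
      using up[OF orb(1-3)[OF z]] unfolding orb(4)[OF z] weight by simp
    from mult_left_mono[OF this K] Suc
    have "norm (Y z) \<le> K * (a * (norm z powi (- \<mu>) * (norm q powi \<mu>) ^ Suc n) * norm (Y (z / q ^ Suc n)))"
      unfolding K_def by (rule order_trans[rotated])
    also have "\<dots> = (a * norm z powi (- \<mu>)) ^ Suc n * (norm q powi \<mu>) ^ tri (Suc n) * norm (Y (z / q ^ Suc n))"
      unfolding K_def tri_Suc power_add power_Suc[of "a * norm z powi (- \<mu>)"] by (simp only: mult_ac)
    finally show ?case .
  qed simp
  have dn_n: "norm (Y (z / q ^ n)) \<le> (b * norm z powi \<mu>) ^ n * (norm q powi (- \<mu>)) ^ tri n * norm (Y z)"
    if z: "z \<in> W" "norm z < \<delta>" for z n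
  proof (induction n)
    case (Suc n)
    define K where "K = b * (norm z powi \<mu> * (norm q powi (- \<mu>)) ^ Suc n)"
    have K: "K \<ge> 0" using pos by (simp add: K_def)
    have "norm (Y (z / q ^ Suc n)) \<le> K * norm (Y (z / q ^ n))"
      using dn[OF orb(1-3)[OF z]] unfolding orb(4)[OF z] weight K_def .
    also have "\<dots> \<le> K * ((b * norm z powi \<mu>) ^ n * (norm q powi (- \<mu>)) ^ tri n * norm (Y z))"
      by (rule mult_left_mono[OF Suc K])
    also have "\<dots> = (b * norm z powi \<mu>) ^ Suc n * (norm q powi (- \<mu>)) ^ tri (Suc n) * norm (Y z)"
      unfolding K_def tri_Suc power_add power_Suc[of "b * norm z powi \<mu>"] by (simp only: mult_ac)
    finally show ?case .
  qed simp
  have ne: "z \<noteq> 0" if "z \<in> W" for z using W(1) that by auto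
  show thesis
    by (rule that[OF pos XY YX up_n dn_n]) (use ne in auto)
qed

section \<open>Flatness of solutions of pure systems\<close>

lemma holomorphic_vec_continuous:
  fixes X :: "complex \<Rightarrow> complex ^ 'n"
  assumes "holomorphic_vec_on X W"
  shows "continuous_on W X"
proof -
  have "continuous_on W (\<lambda>z. \<chi> i. X z $ i)"
    using assms unfolding holomorphic_vec_on_def
    by (intro continuous_on_vec_lambda holomorphic_on_imp_continuous_on) auto
  then show ?thesis by simp
qed

text \<open>
  With theta chosen to have its zeros on an orbit that avoids \<open>W\<close>, the function
  \<open>norm (Y z) * norm (qtheta_at q l z) powi \<mu>\<close> grows from \<open>z\<close> to \<open>z / q\<close> by at most a constant factor:
  the powers of \<open>z\<close> cancel. After \<open>k\<close> steps it has grown at most like a \<open>k\<close>-th power, hence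
  like a power of \<open>norm q ^ k\<close>, which is polynomial in \<open>1 / norm z\<close>. For \<open>\<mu> < 0\<close> it matters that theta
  has no zeros on \<open>W\<close>.
\<close>

lemma pure_solution_t_flat:
  fixes B :: "complex \<Rightarrow> complex ^ 'n ^ 'n" and X :: "complex \<Rightarrow> complex ^ 'n"
  assumes q: "norm q > 1" and germ: "proper_invariant_germ q W"
    and pure: "pure_system q \<mu> B" and hol: "holomorphic_vec_on X W" and sol: "solves_system q W B X"
  shows "t_flat_vec q W \<mu> X"
proof -
  have W: "0 \<notin> W" "\<forall>z\<in>W. z / q \<in> W" using germ by (auto simp: proper_invariant_germ_def)
  have q0: "q \<noteq> 0" using q by auto
  obtain l' where l': "l' \<noteq> 0" "\<And>n::int. l' * q powi n \<notin> W"
    using proper_germ_avoids_orbit[OF q germ] by metis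
  define l where "l = - l'"
  have l: "l \<noteq> 0" using l' by (simp add: l_def)
  have ne: "z \<noteq> 0" if "z \<in> W" for z using W(1) that by auto
  have th0: "qtheta_at q l z \<noteq> 0" if "z \<in> W" for z
    by (rule qtheta_at_nonzero[OF q l ne[OF that]]) (use l'(2) that in \<open>auto simp: l_def\<close>)
  show ?thesis
  proof (rule pure_solution_orbit[OF q W pure sol])
    fix Y :: "complex \<Rightarrow> complex ^ 'n" and a b \<delta> C :: real and N :: nat
    assume pos: "\<delta> > 0" "a > 0" "b > 0" "C > 0" and
      XY: "\<And>z. z \<in> W \<Longrightarrow> norm z < \<delta> \<Longrightarrow> norm (X z) \<le> C * (1 / norm z) ^ N * norm (Y z)" and
      YX: "\<And>z. z \<in> W \<Longrightarrow> norm z < \<delta> \<Longrightarrow> norm (Y z) \<le> C * (1 / norm z) ^ N * norm (X z)" and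
      dn: "\<And>z n. z \<in> W \<Longrightarrow> norm z < \<delta> \<Longrightarrow>
       norm (Y (z / q ^ n)) \<le> (b * norm z powi \<mu>) ^ n * (norm q powi (- \<mu>)) ^ tri n * norm (Y z)"
    obtain N1 where N1: "b * norm l powi \<mu> < norm q ^ N1" using real_arch_pow[OF q] by blast
    have "\<exists>N::nat. (\<lambda>z. norm (X z $ i) * norm (qtheta_at q l z) powi \<mu>)
            \<in> O[at 0 within q_orbit q K](\<lambda>z. norm z powi (- int N))"
      if K: "compact K" "K \<subseteq> W" for K i
    proof -
      have K0: "w \<noteq> 0" if "w \<in> K" for w using ne K that by blast
      obtain R1 where R1: "R1 > 0" "\<And>w. w \<in> K \<Longrightarrow> norm w \<le> R1"
        by (rule compact_continuous_bound[OF K(1), of norm]) (auto intro!: continuous_intros)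
      obtain R2 where R2: "R2 > 0" "\<And>w. w \<in> K \<Longrightarrow> 1 / norm w \<le> R2"
        by (rule compact_continuous_bound[OF K(1), of "\<lambda>w. 1 / norm w"])
           (use K0 in \<open>auto intro!: continuous_intros\<close>)
      obtain n0 where n0: "R1 / \<delta> < norm q ^ n0" using real_arch_pow[OF q] by blast
      \<comment> \<open>Starting from \<open>v w\<close> instead of \<open>w\<close> puts the whole remaining orbit where the equation holds.\<close>
      define v where "v w = w / q ^ n0" for w
      have vW: "v w \<in> W" if "w \<in> K" for w
        unfolding v_def using invariant_divide_power[OF W(2)] K that by blast
      have v\<delta>: "norm (v w) < \<delta>" if "w \<in> K" for w
      proof -
        have "norm w < \<delta> * norm q ^ n0"
          using R1(2)[OF that] n0 pos by (simp add: field_simps)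
        then show ?thesis using q0 by (simp add: v_def norm_divide norm_power field_simps)
      qed
      define H where "H w = norm (Y (v w)) * norm (qtheta_at q l (v w)) powi \<mu>" for w
      have cv: "continuous_on K v" unfolding v_def using q0 by (auto intro!: continuous_intros)
      have cX: "continuous_on K (\<lambda>w. X (v w))"
        by (rule continuous_on_compose2[OF holomorphic_vec_continuous[OF hol] cv]) (use vW in auto)
      have ct: "continuous_on K (\<lambda>w. qtheta_at q l (v w))"
      proof (rule continuous_on_compose2[OF _ cv])
        show "continuous_on W (qtheta_at q l)"
          using isCont_qtheta_at[OF q l ne] by (blast intro: continuous_at_imp_continuous_on)
      qed (use vW in auto)
      obtain M where M: "M > 0" "\<And>w. w \<in> K \<Longrightarrow>
         C * (1 / norm (v w)) ^ N * norm (X (v w)) * norm (qtheta_at q l (v w)) powi \<mu> \<le> M"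
        by (rule compact_continuous_bound[OF K(1), of "\<lambda>w. C * (1 / norm (v w)) ^ N *
             norm (X (v w)) * norm (qtheta_at q l (v w)) powi \<mu>"])
           (use ne[OF vW] th0[OF vW] in \<open>auto intro!: continuous_intros cX ct cv\<close>)
      have HM: "H w \<le> M" if "w \<in> K" for w
      proof -
        have "H w \<le> C * (1 / norm (v w)) ^ N * norm (X (v w)) * norm (qtheta_at q l (v w)) powi \<mu>"
          unfolding H_def by (rule mult_right_mono[OF YX[OF vW v\<delta>]]) (use that in auto)
        with M(2)[OF that] show ?thesis by linarith
      qed
      have key: "norm (X z $ i) * norm (qtheta_at q l z) powi \<mu> \<le>
          (C * M * R1 ^ N1) * (1 / norm z) ^ (N + N1)"
        if z: "z \<in> q_orbit q K" "norm z < 1 / (R2 * norm q ^ n0)" for z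
      proof -
        obtain w n where w: "w \<in> K" and zw: "z = w / q ^ n" using z(1) unfolding q_orbit_def by blast
        \<comment> \<open>fewer than \<open>n0\<close> divisions by \<open>q\<close> do not reach the small disc\<close>
        have "n0 \<le> n"
        proof (rule ccontr)
          assume "\<not> n0 \<le> n"
          then have "norm q ^ n \<le> norm q ^ n0" using q by (intro power_increasing) auto
          have "1 / (R2 * norm q ^ n0) \<le> 1 / ((1 / norm w) * norm q ^ n)"
            using R2(2)[OF w] \<open>norm q ^ n \<le> norm q ^ n0\<close> K0[OF w] R2(1) q0
            by (intro divide_left_mono mult_mono) auto
          also have "\<dots> = norm z" by (simp add: zw norm_divide norm_power)
          finally show False using z(2) by simp
        qed
        then obtain k where k: "n = n0 + k" using le_Suc_ex by blast
        have zv: "z = v w / q ^ k" by (simp add: zw v_def k power_add)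
        note vw = vW[OF w] v\<delta>[OF w]
        have zW: "z \<in> W" unfolding zv by (rule invariant_divide_power[OF W(2) vw(1)])
        have vpos: "norm (v w) > 0" using ne[OF vw(1)] by simp
        have nzv: "norm z = norm (v w) / norm q ^ k" by (simp add: zv norm_divide norm_power)
        have z\<delta>: "norm z < \<delta>"
          using norm_divide_power_le[OF q, of "v w" k] vw(2) unfolding zv by linarith
        define c where "c = norm (qtheta_at q l z) powi \<mu>"
        have c: "c = ((norm l / norm (v w)) powi \<mu>) ^ k * (norm q powi \<mu>) ^ tri k *
           norm (qtheta_at q l (v w)) powi \<mu>"
          unfolding c_def zv qtheta_at_iterate[OF q l ne[OF vw(1)]] norm_mult norm_power norm_divide
            power_int_mult_distrib power_int_power_swap ..
        have "norm (Y z) * c \<le> ((b * norm (v w) powi \<mu>) ^ k * (norm q powi (- \<mu>)) ^ tri k * norm (Y (v w))) * c"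
          unfolding zv by (rule mult_right_mono[OF dn[OF vw]]) (simp add: c_def)
        also have "\<dots> = ((b * norm (v w) powi \<mu> * (norm l / norm (v w)) powi \<mu>) ^ k *
            (norm q powi (- \<mu>) * norm q powi \<mu>) ^ tri k) * H w"
          unfolding c H_def power_mult_distrib by (simp only: mult_ac)
        also have "norm q powi (- \<mu>) * norm q powi \<mu> = 1"
          using q0 by (simp add: power_int_minus)
        also have "b * norm (v w) powi \<mu> * (norm l / norm (v w)) powi \<mu> = b * norm l powi \<mu>"
          using vpos unfolding mult.assoc power_int_mult_distrib[symmetric] by simp
        also have "((b * norm l powi \<mu>) ^ k * 1 ^ tri k) * H w \<le> (norm q ^ N1) ^ k * M"
        proof -
          have "(b * norm l powi \<mu>) ^ k \<le> (norm q ^ N1) ^ k"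
            using N1 pos by (intro power_mono) auto
          then show ?thesis
            using HM[OF w] M by (auto intro!: mult_mono simp: H_def)
        qed
        also have "(norm q ^ N1) ^ k = (norm q ^ k) ^ N1"
          by (simp only: power_mult[symmetric] mult.commute)
        also have "norm q ^ k = norm (v w) * (1 / norm z)"
          using vpos q0 by (simp add: nzv)
        also have "(norm (v w) * (1 / norm z)) ^ N1 * M \<le> (R1 * (1 / norm z)) ^ N1 * M"
        proof -
          have "norm (v w) \<le> R1"
            unfolding v_def using norm_divide_power_le[OF q, of w n0] R1(2)[OF w] by linarith
          then show ?thesis using M(1) by (intro mult_right_mono power_mono) auto
        qed
        finally have Yc: "norm (Y z) * c \<le> (R1 * (1 / norm z)) ^ N1 * M" .
        have "norm (X z $ i) * c \<le> norm (X z) * c"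
          by (intro mult_right_mono Finite_Cartesian_Product.norm_nth_le) (simp add: c_def)
        also have "\<dots> \<le> (C * (1 / norm z) ^ N * norm (Y z)) * c"
          by (rule mult_right_mono[OF XY[OF zW z\<delta>]]) (simp add: c_def)
        also have "\<dots> = C * (1 / norm z) ^ N * (norm (Y z) * c)" by (simp only: mult.assoc)
        also have "\<dots> \<le> C * (1 / norm z) ^ N * ((R1 * (1 / norm z)) ^ N1 * M)"
          by (rule mult_left_mono[OF Yc]) (use pos in simp)
        also have "\<dots> = (C * M * R1 ^ N1) * (1 / norm z) ^ (N + N1)"
          unfolding power_mult_distrib power_add by (simp only: mult_ac)
        finally show ?thesis by (simp add: c_def)
      qed
      have "(\<lambda>z. norm (X z $ i) * norm (qtheta_at q l z) powi \<mu>)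
            \<in> O[at 0 within q_orbit q K](\<lambda>z. norm z powi (- int (N + N1)))"
      proof (rule bigoI)
        show "eventually (\<lambda>z. norm (norm (X z $ i) * norm (qtheta_at q l z) powi \<mu>) \<le>
           (C * M * R1 ^ N1) * norm (norm z powi (- int (N + N1)))) (at 0 within q_orbit q K)"
          unfolding eventually_at
        proof (intro exI[of _ "1 / (R2 * norm q ^ n0)"] conjI ballI impI)
          show "0 < 1 / (R2 * norm q ^ n0)" using R2(1) q0 by simp
          fix z assume "z \<in> q_orbit q K" "z \<noteq> 0 \<and> dist z 0 < 1 / (R2 * norm q ^ n0)"
          then have "norm (X z $ i) * norm (qtheta_at q l z) powi \<mu> \<le>
              (C * M * R1 ^ N1) * (1 / norm z) ^ (N + N1)" by (intro key) auto
          moreover have "norm (norm z powi (- int (N + N1))) = (1 / norm z) ^ (N + N1)"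
            unfolding power_int_minus power_int_of_nat
            by (simp add: inverse_eq_divide power_one_over)
          ultimately show "norm (norm (X z $ i) * norm (qtheta_at q l z) powi \<mu>) \<le>
             (C * M * R1 ^ N1) * norm (norm z powi (- int (N + N1)))" by simp
        qed
      qed
      then show ?thesis by blast
    qed
    then show ?thesis unfolding t_flat_vec_def t_flat_def using l by blast
  qed
qed

text \<open>
  At a point \<open>z\<close> off the zeros of the theta functions, \<open>t\<close>-flatness bounds \<open>X\<close> at \<open>z / q ^ n\<close> by the
  \<open>tri n\<close>-th power of \<open>norm q powi (- t)\<close>, up to a geometric factor, while the equation recovers \<open>Y z\<close>
  from it at the cost of the \<open>tri n\<close>-th power of \<open>norm q powi \<mu>\<close>. As \<open>\<mu> < t\<close>, the product tends to
  \<open>0\<close>, so \<open>Y z = 0\<close>. The exceptional points are countable, hence of empty interior, and continuity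
  takes care of them.
\<close>

lemma pure_solution_vanishes:
  fixes B :: "complex \<Rightarrow> complex ^ 'n ^ 'n" and X :: "complex \<Rightarrow> complex ^ 'n"
  assumes q: "norm q > 1" and W: "open W" "0 \<notin> W" "\<forall>z\<in>W. z / q \<in> W"
    and pure: "pure_system q \<mu> B" and hol: "holomorphic_vec_on X W" and sol: "solves_system q W B X"
    and t: "t > \<mu>" and flat: "t_flat_vec q W t X"
  shows "\<forall>\<^sub>F z in at 0 within W. X z = 0"
proof -
  have q0: "q \<noteq> 0" using q by auto
  have ne: "z \<noteq> 0" if "z \<in> W" for z using W(2) that by auto
  have "\<forall>i. \<exists>l. l \<noteq> 0 \<and> (\<forall>K. compact K \<longrightarrow> K \<subseteq> W \<longrightarrow> (\<exists>C N n0. C \<ge> 0 \<and>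
       (\<forall>n\<ge>n0. \<forall>w\<in>K.
       norm (X (w / q ^ n) $ i) * (((norm l / norm w) powi t) ^ n * (norm q powi t) ^ tri n *
         norm (qtheta_at q l w) powi t) \<le> C * (norm q ^ n / norm w) ^ N)))"
  proof
    fix i
    from flat have "t_flat q W t (\<lambda>z. X z $ i)" by (simp add: t_flat_vec_def)
    from t_flat_orbit_bound[OF q W(2) this]
    show "\<exists>l. l \<noteq> 0 \<and> (\<forall>K. compact K \<longrightarrow> K \<subseteq> W \<longrightarrow> (\<exists>C N n0. C \<ge> 0 \<and>
       (\<forall>n\<ge>n0. \<forall>w\<in>K.
       norm (X (w / q ^ n) $ i) * (((norm l / norm w) powi t) ^ n * (norm q powi t) ^ tri n *
         norm (qtheta_at q l w) powi t) \<le> C * (norm q ^ n / norm w) ^ N)))" by metis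
  qed
  then obtain l where l: "\<And>i. l i \<noteq> 0" and
    lK: "\<And>i K. compact K \<Longrightarrow> K \<subseteq> W \<Longrightarrow> \<exists>C N n0. C \<ge> 0 \<and> (\<forall>n\<ge>n0. \<forall>w\<in>K.
       norm (X (w / q ^ n) $ i) * (((norm (l i) / norm w) powi t) ^ n * (norm q powi t) ^ tri n *
         norm (qtheta_at q (l i) w) powi t) \<le> C * (norm q ^ n / norm w) ^ N)"
    by metis
  show ?thesis
  proof (rule pure_solution_orbit[OF q W(2,3) pure sol])
    fix Y :: "complex \<Rightarrow> complex ^ 'n" and a b \<delta> C :: real and N :: nat
    assume pos: "\<delta> > 0" "a > 0" "b > 0" "C > 0" and
      XY: "\<And>z. z \<in> W \<Longrightarrow> norm z < \<delta> \<Longrightarrow> norm (X z) \<le> C * (1 / norm z) ^ N * norm (Y z)" and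
      YX: "\<And>z. z \<in> W \<Longrightarrow> norm z < \<delta> \<Longrightarrow> norm (Y z) \<le> C * (1 / norm z) ^ N * norm (X z)" and
      up: "\<And>z n. z \<in> W \<Longrightarrow> norm z < \<delta> \<Longrightarrow>
       norm (Y z) \<le> (a * norm z powi (- \<mu>)) ^ n * (norm q powi \<mu>) ^ tri n * norm (Y (z / q ^ n))"
    \<comment> \<open>Each component of \<open>X\<close> comes with its own theta function, hence its own orbit of zeros.\<close>
    define Z where "Z = (\<Union>i. range (\<lambda>n::int. - l i * q powi n))"
    have Z: "countable Z" unfolding Z_def by auto
    define S where "S = norm q powi \<mu>"
    define s where "s = norm q powi t"
    have s: "s > 0" using q0 by (simp add: s_def)
    have S: "S > 0" using q0 by (simp add: S_def)
    have "S < s" unfolding S_def s_def by (rule power_int_strict_increasing) (use q t in auto)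
    then have r: "0 \<le> S * inverse s" "S * inverse s < 1" using s S by (auto simp: field_simps)
    have off: "X z = 0" if z: "z \<in> W" "norm z < \<delta>" "z \<notin> Z" for z
    proof -
      define P where "P = a * norm z powi (- \<mu>)"
      have P: "P > 0" using pos ne[OF z(1)] by (simp add: P_def)
      \<comment> \<open>the contribution of the \<open>i\<close>-th component of \<open>X\<close> at \<open>z / q ^ n\<close> to the bound for \<open>Y z\<close>\<close>
      define x where "x i n = P ^ n * S ^ tri n * (C * (norm q ^ n / norm z) ^ N * norm (X (z / q ^ n) $ i))"
        for i n
      have lim: "x i \<longlonglongrightarrow> 0" for i
      proof -
        have "z \<noteq> - l i * q powi n" for n :: int using z(3) unfolding Z_def by blast
        then have T: "norm (qtheta_at q (l i) z) powi t > 0" (is "?T > 0")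
          using qtheta_at_nonzero[OF q l ne[OF z(1)]] by (intro zero_less_power_int) auto
        define u where "u = (norm (l i) / norm z) powi t"
        have u: "u > 0" unfolding u_def using l ne[OF z(1)] by (intro zero_less_power_int) auto
        have "compact {z}" "{z} \<subseteq> W" using z by auto
        from lK[OF this, of i] obtain D M n0 where D: "D \<ge> 0" and
          bd: "\<And>n. n \<ge> n0 \<Longrightarrow> norm (X (z / q ^ n) $ i) * (u ^ n * s ^ tri n * ?T) \<le> D * (norm q ^ n / norm z) ^ M"
          unfolding u_def s_def by blast
        define E where "E = C * D * inverse ?T * (1 / norm z) ^ (N + M)"
        define G where "G = P * norm q ^ (N + M) * inverse u"
        have "x i n \<le> E * (G ^ n * (S * inverse s) ^ tri n)" if n: "n \<ge> n0" for n
        proof -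
          have "norm (X (z / q ^ n) $ i) \<le> D * (norm q ^ n / norm z) ^ M / (u ^ n * s ^ tri n * ?T)"
            using bd[OF n] u s T by (subst pos_le_divide_eq) auto
          also have "\<dots> = D * (norm q ^ n / norm z) ^ M * (inverse u ^ n * inverse s ^ tri n * inverse ?T)"
            by (simp add: divide_inverse power_inverse)
          finally have "x i n \<le> P ^ n * S ^ tri n * (C * (norm q ^ n / norm z) ^ N *
             (D * (norm q ^ n / norm z) ^ M * (inverse u ^ n * inverse s ^ tri n * inverse ?T)))"
            unfolding x_def by (intro mult_left_mono) (use P S pos in auto)
          also have "\<dots> = C * D * inverse ?T * ((norm q ^ n / norm z) ^ N * (norm q ^ n / norm z) ^ M) *
              (P ^ n * inverse u ^ n) * (S ^ tri n * inverse s ^ tri n)"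
            by (simp only: mult_ac)
          also have "\<dots> = E * (G ^ n * (S * inverse s) ^ tri n)"
            unfolding orbit_power_mult E_def G_def power_mult_distrib by (simp only: mult_ac)
          finally show ?thesis .
        qed
        then have "\<forall>\<^sub>F n in sequentially. x i n \<le> E * (G ^ n * (S * inverse s) ^ tri n)"
          by (auto simp: eventually_sequentially)
        moreover have "\<forall>\<^sub>F n in sequentially. 0 \<le> x i n"
          unfolding x_def using P S pos by (intro always_eventually) auto
        moreover have "(\<lambda>n. E * (G ^ n * (S * inverse s) ^ tri n)) \<longlonglongrightarrow> 0"
          using tendsto_mult_left[OF gauss_weight_tendsto_0[OF r, of G], of E] by simp
        ultimately show ?thesis
          by (intro tendsto_sandwich[of "\<lambda>_. 0" "x i" sequentially "\<lambda>n. E * (G ^ n * (S * inverse s) ^ tri n)"]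
                tendsto_const)
      qed
      have "norm (Y z) \<le> (\<Sum>i\<in>UNIV. x i n)" for n
      proof -
        have orbW: "z / q ^ n \<in> W" by (rule invariant_divide_power[OF W(3) z(1)])
        have "norm (z / q ^ n) < \<delta>" using norm_divide_power_le[OF q, of z n] z(2) by linarith
        from YX[OF orbW this]
        have "norm (Y (z / q ^ n)) \<le> C * (norm q ^ n / norm z) ^ N * norm (X (z / q ^ n))"
          by (simp add: norm_divide norm_power)
        also have "\<dots> \<le> C * (norm q ^ n / norm z) ^ N * (\<Sum>i\<in>UNIV. norm (X (z / q ^ n) $ i))"
          unfolding norm_vec_def by (intro mult_left_mono L2_set_le_sum) (use pos in auto)
        finally have "P ^ n * S ^ tri n * norm (Y (z / q ^ n)) \<le> P ^ n * S ^ tri n *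
           (C * (norm q ^ n / norm z) ^ N * (\<Sum>i\<in>UNIV. norm (X (z / q ^ n) $ i)))"
          by (intro mult_left_mono) (use P S in auto)
        also have "\<dots> = (\<Sum>i\<in>UNIV. x i n)" unfolding x_def sum_distrib_left ..
        finally show ?thesis using up[OF z(1,2), of n] by (simp add: P_def S_def)
      qed
      moreover have "(\<lambda>n. \<Sum>i\<in>UNIV. x i n) \<longlonglongrightarrow> (\<Sum>i\<in>(UNIV::'n set). 0)"
        by (intro tendsto_sum lim)
      ultimately have "norm (Y z) \<le> 0" by (intro LIMSEQ_le_const[of _ 0]) auto
      with XY[OF z(1,2)] show ?thesis by simp
    qed
    have "X z = 0" if z: "z \<in> W" "norm z < \<delta>" for z
    proof (rule ccontr)
      assume "X z \<noteq> 0"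
      have "open (W \<inter> ball 0 \<delta>)" using W(1) by auto
      moreover have "continuous_on (W \<inter> ball 0 \<delta>) X"
        using continuous_on_subset[OF holomorphic_vec_continuous[OF hol]] by blast
      ultimately have "open ((W \<inter> ball 0 \<delta>) \<inter> X -` (- {0}))"
        by (intro continuous_open_preimage) auto
      moreover have "z \<in> (W \<inter> ball 0 \<delta>) \<inter> X -` (- {0})" using z \<open>X z \<noteq> 0\<close> by auto
      ultimately obtain e where "e > 0" "ball z e \<subseteq> (W \<inter> ball 0 \<delta>) \<inter> X -` (- {0})"
        using open_contains_ball by blast
      moreover have "ball z e - Z \<noteq> {}" by (rule ball_minus_countable_nonempty[OF Z \<open>e > 0\<close>])
      ultimately obtain y where "y \<in> (W \<inter> ball 0 \<delta>) \<inter> X -` (- {0})" "y \<notin> Z" by blast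
      then show False using off[of y] by simp
    qed
    then show ?thesis unfolding eventually_at using pos(1) by auto
  qed
qed

theorem lemma2p7:
  fixes q :: complex and W :: "complex set"
  assumes "norm q > 1"
    and "proper_invariant_germ q W"
  shows "(\<forall>(t::int) f. t > 0 \<and> f holomorphic_on W \<and> t_flat q W t f \<longrightarrow> asymp_flat q W f) \<and>
    (\<forall>(t::int) (X :: complex \<Rightarrow> complex ^ 'n).
       t > 0 \<and> holomorphic_vec_on X W \<and> t_flat_vec q W t X \<longrightarrow> asymp_flat_vec q W X) \<and>
    (\<forall>(\<mu>::int) (B :: complex \<Rightarrow> complex ^ 'n ^ 'n) X.
       pure_system q \<mu> B \<and> holomorphic_vec_on X W \<and> solves_system q W B X
       \<longrightarrow> t_flat_vec q W \<mu> X) \<and>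
    (\<forall>(\<mu>::int) (t::int) (B :: complex \<Rightarrow> complex ^ 'n ^ 'n) X.
       pure_system q \<mu> B \<and> holomorphic_vec_on X W \<and> solves_system q W B X
       \<and> t > \<mu> \<and> t_flat_vec q W t X
       \<longrightarrow> (\<forall>\<^sub>F z in at 0 within W. X z = 0))"
proof -
  have W: "open W" "0 \<notin> W" "\<forall>z\<in>W. z / q \<in> W"
    using assms(2) by (auto simp: proper_invariant_germ_def)
  note flat = t_flat_imp_asymp_flat[OF assms(1) W]
  show ?thesis
  proof (intro conjI allI impI)
    fix t :: int and f assume "t > 0 \<and> f holomorphic_on W \<and> t_flat q W t f"
    then show "asymp_flat q W f" using flat by blast
  next
    fix t :: int and X :: "complex \<Rightarrow> complex ^ 'n"
    assume "t > 0 \<and> holomorphic_vec_on X W \<and> t_flat_vec q W t X"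
    then show "asymp_flat_vec q W X"
      unfolding asymp_flat_vec_def holomorphic_vec_on_def t_flat_vec_def using flat by blast
  next
    fix \<mu> :: int and B :: "complex \<Rightarrow> complex ^ 'n ^ 'n" and X
    assume "pure_system q \<mu> B \<and> holomorphic_vec_on X W \<and> solves_system q W B X"
    then show "t_flat_vec q W \<mu> X" using pure_solution_t_flat[OF assms] by blast
  next
    fix \<mu> t :: int and B :: "complex \<Rightarrow> complex ^ 'n ^ 'n" and X
    assume "pure_system q \<mu> B \<and> holomorphic_vec_on X W \<and> solves_system q W B X
       \<and> t > \<mu> \<and> t_flat_vec q W t X"
    then show "\<forall>\<^sub>F z in at 0 within W. X z = 0"
      using pure_solution_vanishes[OF assms(1) W] by blast
  qed
qed

end
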